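(* Let $k \ge 2$ be an integer and let $G$ be a connected simple graph of order $n \ge 2k+8$ with minimum degree $\delta \ge k+2$. If \[ \rho_D(G) \le \rho_D\big(K_{k-1} \vee (K_{n-k} \cup K_1)\big), \] then $G$ has property $P(k, \delta)$.
   Context: All graphs are finite, undirected and simple. For a connected graph $G$ with vertices $v_1,\dots,v_n$, the distance matrix $D(G)$ is the $n\times n$ matrix whose $(i,j)$-entry is the length of a shortest path between $v_i$ and $v_j$; $\rho_D(G)$ denotes its largest eigenvalue (the distance spectral radius). $K_m$ is the complete graph on $m$ vertices, $G_1 \cup G_2$ is the disjoint union, and $G_1 \vee G_2$ (join) is obtained from $G_1 \cup G_2$ by adding all edges between $V(G_1)$ and $V(G_2)$. For positive integers $k,d$, a graph $G$ of order $n$ has property $P(k,d)$ if: (a) $G$ contains $k$ edge-disjoint spanning trees; (b) there is a forest $F$ in $G$, edge-disjoint from these $k$ spanning trees, with $|E(F)| > \frac{d-1}{d}(n-1)$; and (c) if $F$ is not a spanning tree, then $F$ has a component with at least $d$ edges. *)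

theory Defs
  imports "Jordan_Normal_Form.Spectral_Radius"
begin

record 'a ugraph =
  verts :: "'a set"
  edges :: "'a set set"

definition simple_graph :: "'a ugraph \<Rightarrow> bool" where
  "simple_graph G \<longleftrightarrow> finite (verts G) \<and> (\<forall>e\<in>edges G. e \<subseteq> verts G \<and> card e = 2)"

definition order_graph :: "'a ugraph \<Rightarrow> nat" where
  "order_graph G = card (verts G)"

definition degree_in :: "'a ugraph \<Rightarrow> 'a \<Rightarrow> nat" where
  "degree_in G v = card {e \<in> edges G. v \<in> e}"

definition min_degree :: "'a ugraph \<Rightarrow> nat" where
  "min_degree G = Min (degree_in G ` verts G)"

text \<open>A path is given by its nonempty list of pairwise distinct vertices; its length is the number
  of edges, i.e. one less than the length of the list.\<close>

definition is_path :: "'a ugraph \<Rightarrow> 'a list \<Rightarrow> bool" where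
  "is_path G p \<longleftrightarrow> p \<noteq> [] \<and> distinct p \<and> set p \<subseteq> verts G \<and>
     successively (\<lambda>u v. {u, v} \<in> edges G) p"

definition path_between :: "'a ugraph \<Rightarrow> 'a \<Rightarrow> 'a list \<Rightarrow> 'a \<Rightarrow> bool" where
  "path_between G u p v \<longleftrightarrow> is_path G p \<and> hd p = u \<and> last p = v"

definition path_length :: "'a list \<Rightarrow> nat" where
  "path_length p = length p - 1"

definition connected_graph :: "'a ugraph \<Rightarrow> bool" where
  "connected_graph G \<longleftrightarrow> verts G \<noteq> {} \<and> (\<forall>u\<in>verts G. \<forall>v\<in>verts G. \<exists>p. path_between G u p v)"

definition distance :: "'a ugraph \<Rightarrow> 'a \<Rightarrow> 'a \<Rightarrow> nat" where
  "distance G u v = (LEAST l. \<exists>p. path_between G u p v \<and> path_length p = l)"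

definition distance_matrix :: "'a ugraph \<Rightarrow> 'a list \<Rightarrow> real mat" where
  "distance_matrix G vs =
     mat (length vs) (length vs) (\<lambda>(i, j). real (distance G (vs ! i) (vs ! j)))"

text \<open>The enumeration of the vertices is arbitrary; by the lemma below the spectrum of the distance
  matrix does not depend on it.\<close>

definition vertex_enum :: "'a ugraph \<Rightarrow> 'a list" where
  "vertex_enum G = (SOME vs. distinct vs \<and> set vs = verts G)"

definition distance_spectral_radius :: "'a ugraph \<Rightarrow> real" (\<open>\<rho>\<^sub>D\<close>) where
  "\<rho>\<^sub>D G = Max (spectrum (distance_matrix G (vertex_enum G)))"

lemma eigenvalue_distance_matrix_iff:
  assumes "distinct vs"
  shows "eigenvalue (distance_matrix G vs) x \<longleftrightarrow>
    (\<exists>f. (\<exists>v\<in>set vs. f v \<noteq> 0) \<and>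
         (\<forall>u\<in>set vs. (\<Sum>v\<in>set vs. real (distance G u v) * f v) = x * f u))"
  (is "?L \<longleftrightarrow> ?R")
proof -
  let ?n = "length vs" and ?A = "distance_matrix G vs"
  have dim: "dim_row ?A = ?n" by (simp add: distance_matrix_def)
  have sum_eq: "(\<Sum>v\<in>set vs. g v) = (\<Sum>i<?n. g (vs ! i))" for g :: "'a \<Rightarrow> real"
    using sum.reindex_bij_betw[OF bij_betw_nth[OF assms refl refl], of g] by simp
  have entry: "(?A *\<^sub>v w) $ i = (\<Sum>j<?n. real (distance G (vs ! i) (vs ! j)) * w $ j)"
    if "w \<in> carrier_vec ?n" "i < ?n" for w i
    using that by (simp add: distance_matrix_def scalar_prod_def lessThan_atLeast0)
  have dim_mult: "dim_vec (?A *\<^sub>v w) = ?n" for w by (simp add: distance_matrix_def)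
  show ?thesis
  proof
    assume ?L
    then obtain w where w: "w \<in> carrier_vec ?n" "w \<noteq> 0\<^sub>v ?n" "?A *\<^sub>v w = x \<cdot>\<^sub>v w"
      unfolding eigenvalue_def eigenvector_def dim by blast
    define f where "f v = w $ (THE i. i < ?n \<and> vs ! i = v)" for v
    have f: "f (vs ! i) = w $ i" if "i < ?n" for i
    proof -
      have "(THE j. j < ?n \<and> vs ! j = vs ! i) = i"
        using that assms by (intro the_equality) (auto simp: nth_eq_iff_index_eq)
      then show ?thesis by (simp add: f_def)
    qed
    obtain i where i: "i < ?n" "w $ i \<noteq> 0"
      using w(1,2) by (metis carrier_vecD eq_vecI index_zero_vec(1) index_zero_vec(2))
    have "\<exists>v\<in>set vs. f v \<noteq> 0" using i f by (intro bexI[of _ "vs ! i"]) auto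
    moreover have "(\<Sum>v\<in>set vs. real (distance G u v) * f v) = x * f u" if u: "u \<in> set vs" for u
    proof -
      obtain i where i: "i < ?n" "u = vs ! i" using u by (auto simp: in_set_conv_nth)
      have "(\<Sum>v\<in>set vs. real (distance G u v) * f v) = (?A *\<^sub>v w) $ i"
        using i w(1) by (simp add: sum_eq entry f)
      then show ?thesis using w i by (simp add: f)
    qed
    ultimately show ?R by blast
  next
    assume ?R
    then obtain f where f: "\<exists>v\<in>set vs. f v \<noteq> 0"
      "\<forall>u\<in>set vs. (\<Sum>v\<in>set vs. real (distance G u v) * f v) = x * f u" by blast
    define w where "w = vec ?n (\<lambda>i. f (vs ! i))"
    have w: "w \<in> carrier_vec ?n" by (simp add: w_def)
    have "w \<noteq> 0\<^sub>v ?n"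
    proof -
      obtain i where "i < ?n" "f (vs ! i) \<noteq> 0" using f(1) by (auto simp: in_set_conv_nth)
      then have "w $ i \<noteq> 0\<^sub>v ?n $ i" by (simp add: w_def)
      then show ?thesis by metis
    qed
    moreover have "?A *\<^sub>v w = x \<cdot>\<^sub>v w"
    proof (rule eq_vecI)
      show "dim_vec (?A *\<^sub>v w) = dim_vec (x \<cdot>\<^sub>v w)" using dim_mult w by simp
      fix i assume "i < dim_vec (x \<cdot>\<^sub>v w)"
      then have i: "i < ?n" using w by simp
      have "(?A *\<^sub>v w) $ i = (\<Sum>v\<in>set vs. real (distance G (vs ! i) v) * f v)"
        unfolding entry[OF w i] sum_eq by (simp add: w_def)
      also have "\<dots> = x * f (vs ! i)" using f(2) i by simp
      finally show "(?A *\<^sub>v w) $ i = (x \<cdot>\<^sub>v w) $ i" using i by (simp add: w_def)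
    qed
    ultimately show ?L using w unfolding eigenvalue_def eigenvector_def dim by blast
  qed
qed

lemma spectrum_distance_matrix_enum_indep:
  assumes "distinct vs" "distinct ws" "set vs = set ws"
  shows "spectrum (distance_matrix G vs) = spectrum (distance_matrix G ws)"
  using assms unfolding spectrum_def by (intro Collect_cong) (simp add: eigenvalue_distance_matrix_iff)

definition complete_graph :: "nat \<Rightarrow> nat ugraph" where
  "complete_graph m = \<lparr>verts = {..<m}, edges = {{u, v} | u v. u < m \<and> v < m \<and> u \<noteq> v}\<rparr>"

definition graph_union :: "'a ugraph \<Rightarrow> 'b ugraph \<Rightarrow> ('a + 'b) ugraph" where
  "graph_union G H =
     \<lparr>verts = verts G <+> verts H,
      edges = (\<lambda>e. Inl ` e) ` edges G \<union> (\<lambda>e. Inr ` e) ` edges H\<rparr>"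

definition graph_join :: "'a ugraph \<Rightarrow> 'b ugraph \<Rightarrow> ('a + 'b) ugraph" where
  "graph_join G H =
     \<lparr>verts = verts (graph_union G H),
      edges = edges (graph_union G H) \<union> {{Inl u, Inr v} | u v. u \<in> verts G \<and> v \<in> verts H}\<rparr>"

definition is_cycle :: "'a ugraph \<Rightarrow> 'a list \<Rightarrow> bool" where
  "is_cycle G c \<longleftrightarrow> is_path G c \<and> length c \<ge> 3 \<and> {last c, hd c} \<in> edges G"

definition forest :: "'a ugraph \<Rightarrow> bool" where
  "forest G \<longleftrightarrow> simple_graph G \<and> \<not> (\<exists>c. is_cycle G c)"

definition tree :: "'a ugraph \<Rightarrow> bool" where
  "tree G \<longleftrightarrow> forest G \<and> connected_graph G"

definition subgraph :: "'a ugraph \<Rightarrow> 'a ugraph \<Rightarrow> bool" where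
  "subgraph H G \<longleftrightarrow> simple_graph H \<and> verts H \<subseteq> verts G \<and> edges H \<subseteq> edges G"

definition spanning_tree :: "'a ugraph \<Rightarrow> 'a ugraph \<Rightarrow> bool" where
  "spanning_tree T G \<longleftrightarrow> tree T \<and> subgraph T G \<and> verts T = verts G"

definition component :: "'a ugraph \<Rightarrow> 'a ugraph \<Rightarrow> bool" where
  "component C G \<longleftrightarrow> subgraph C G \<and> connected_graph C \<and>
     (\<forall>H. subgraph H G \<and> connected_graph H \<and> subgraph C H \<longrightarrow> H = C)"

definition edge_disjoint :: "'a ugraph \<Rightarrow> 'a ugraph \<Rightarrow> bool" where
  "edge_disjoint G H \<longleftrightarrow> edges G \<inter> edges H = {}"

definition property_P :: "nat \<Rightarrow> nat \<Rightarrow> 'a ugraph \<Rightarrow> bool" where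
  "property_P k d G \<longleftrightarrow>
     (\<exists>T F.
        (\<forall>i<k. spanning_tree (T i) G) \<and>
        (\<forall>i<k. \<forall>j<k. i \<noteq> j \<longrightarrow> edge_disjoint (T i) (T j)) \<and>
        forest F \<and> subgraph F G \<and> (\<forall>i<k. edge_disjoint F (T i)) \<and>
        real (card (edges F)) > (real d - 1) / real d * (real (order_graph G) - 1) \<and>
        (\<not> spanning_tree F G \<longrightarrow> (\<exists>C. component C F \<and> card (edges C) \<ge> d)))"

end

theory Submission
  imports Defs "HOL-Analysis.Function_Topology" "HOL-Library.Disjoint_Sets"
begin

text \<open>
  In fact \<open>G\<close> has \<open>k + 1\<close> edge-disjoint spanning trees, and one of them serves as the forest. The
  extremal graph has distance spectral radius less than \<open>n + 2\<close> (test vector), while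
  \<open>\<rho>\<^sub>D(G)\<close> is at least the mean row sum of the distance matrix, which is at least
  \<open>2 (n - 1) - 2 |E| / n\<close> because non-adjacent vertices have distance at least 2. Hence
  \<open>2 |E| > n (n - 4)\<close>, and with the degree condition every partition of the vertices into \<open>p\<close>
  classes is crossed by at least \<open>(k + 1) (p - 1)\<close> edges, so the tree packing theorem of
  Nash-Williams and Tutte applies. For the latter, take a packing of forests with a maximum number
  of edges and let \<open>S\<close> be the set of edges left uncovered by some packing reachable from it by
  exchanges; each forest restricted to \<open>S\<close> has the same components as \<open>S\<close>, and counting edges
  against these components shows that all forests are spanning trees.
\<close>

section \<open>Connectivity by a set of edges\<close>

text \<open>Connectivity is attached to a bare edge set, so that deleting, exchanging and
  intersecting edges needs no change of graph. Only members of the form \<open>{x, y}\<close>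
  contribute.\<close>

definition conn :: "'a set set \<Rightarrow> 'a \<Rightarrow> 'a \<Rightarrow> bool" where
  "conn A = (\<lambda>x y. {x, y} \<in> A)\<^sup>*\<^sup>*"

lemma conn_refl [simp]: "conn A x x"
  by (simp add: conn_def)

lemma conn_trans [trans]: "conn A x y \<Longrightarrow> conn A y z \<Longrightarrow> conn A x z"
  unfolding conn_def by (rule rtranclp_trans)

lemma conn_edge: "{x, y} \<in> A \<Longrightarrow> conn A x y"
  unfolding conn_def by (rule r_into_rtranclp)

lemma conn_sym: "conn A x y \<Longrightarrow> conn A y x"
proof -
  have "symp (\<lambda>x y. {x, y} \<in> A)"
    by (rule sympI) (simp add: insert_commute)
  then show "conn A x y \<Longrightarrow> conn A y x"
    unfolding conn_def by (metis sympD symp_rtranclp)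
qed

lemma conn_by_edges:
  assumes "conn A u v" and "\<And>x y. {x, y} \<in> A \<Longrightarrow> conn B x y"
  shows "conn B u v"
  using assms(1) unfolding conn_def
proof (induction rule: rtranclp_induct)
  case (step y z)
  then show ?case
    using assms(2)[of y z] conn_trans[of B u y z] by (simp add: conn_def)
qed simp

lemma conn_mono: "conn A u v \<Longrightarrow> A \<subseteq> B \<Longrightarrow> conn B u v"
  by (rule conn_by_edges) (auto intro: conn_edge)

text \<open>A walk that traverses the new edge forth and back can be cut short, so at most one
  traversal matters; the two last cases are its two directions.\<close>

lemma conn_insertD:
  assumes "conn (insert {a, b} A) u v"
  shows "conn A u v \<or> conn A u a \<and> conn A b v \<or> conn A u b \<and> conn A a v"
  using assms unfolding conn_def[of "insert {a, b} A"]
proof (induction rule: rtranclp_induct)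
  case (step y z)
  then consider "{y, z} \<in> A" | "y = a" "z = b" | "y = b" "z = a"
    by (auto simp: doubleton_eq_iff)
  then show ?case
  proof cases
    case 1
    then show ?thesis using step.IH conn_edge conn_trans by metis
  next
    case 2
    then show ?thesis using step.IH conn_refl conn_trans conn_sym by metis
  next
    case 3
    then show ?thesis using step.IH conn_refl conn_trans conn_sym by metis
  qed
qed simp

text \<open>Every walk from \<open>u\<close> to \<open>v\<close> must use \<open>f\<close>. The
  names are chosen so that \<open>x\<close> is the end of \<open>f\<close> on the side of
  \<open>u\<close> and \<open>y\<close> the one on the side of \<open>v\<close>.\<close>

lemma conn_bridge:
  assumes "conn A u v" and "\<not> conn (A - {f}) u v"
  obtains x y where "f = {x, y}" "conn (A - {f}) u x" "conn (A - {f}) y v"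
proof -
  have "\<exists>x y. f = {x, y}"
  proof (rule ccontr)
    assume "\<nexists>x y. f = {x, y}"
    then have "conn (A - {f}) u v"
      using assms(1) by (elim conn_by_edges) (auto intro!: conn_edge)
    then show False using assms(2) by simp
  qed
  then obtain a b where f: "f = {a, b}" by blast
  have "conn (insert {a, b} (A - {f})) u v"
    using assms(1) by (rule conn_mono) (auto simp: f)
  from conn_insertD[OF this] assms(2) show thesis
    using that[of a b] that[of b a] by (auto simp: f insert_commute)
qed

text \<open>A forest is encoded by the condition that each edge is a bridge, which suits exchange
  arguments better than cycles as lists. The case \<open>a = b\<close> rules out loops, because
  \<open>conn\<close> is reflexive.\<close>

definition acyclic_edges :: "'a set set \<Rightarrow> bool" where
  "acyclic_edges A \<longleftrightarrow> (\<forall>a b. {a, b} \<in> A \<longrightarrow> \<not> conn (A - {{a, b}}) a b)"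

lemma acyclic_edges_subset:
  assumes "acyclic_edges B" and "A \<subseteq> B"
  shows "acyclic_edges A"
  unfolding acyclic_edges_def
proof (intro allI impI notI)
  fix a b
  assume ab: "{a, b} \<in> A" and "conn (A - {{a, b}}) a b"
  then have "conn (B - {{a, b}}) a b" using assms(2) by (elim conn_mono) auto
  moreover have "{a, b} \<in> B" using ab assms(2) by blast
  ultimately show False using assms(1) by (simp add: acyclic_edges_def)
qed

text \<open>A cycle through an old edge \<open>{c, d}\<close> would have to use the new edge as
  well; the rest of that cycle would already join \<open>a\<close> to \<open>b\<close> in
  \<open>A\<close>.\<close>

lemma acyclic_edges_insert:
  assumes "acyclic_edges A" and "\<not> conn A a b"
  shows "acyclic_edges (insert {a, b} A)"
  unfolding acyclic_edges_def
proof (intro allI impI notI)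
  fix c d
  assume cd: "{c, d} \<in> insert {a, b} A" and conn: "conn (insert {a, b} A - {{c, d}}) c d"
  show False
  proof (cases "{c, d} = {a, b}")
    case True
    then have "conn A c d" using conn by (elim conn_mono) auto
    then have "conn A a b" using True conn_sym by (metis doubleton_eq_iff)
    then show False using assms(2) by simp
  next
    case False
    let ?B = "A - {{c, d}}"
    from False have cdA: "{c, d} \<in> A" using cd by simp
    have no: "\<not> conn ?B c d" using assms(1) cdA by (simp add: acyclic_edges_def)
    have "conn (insert {a, b} ?B) c d" using conn by (elim conn_mono) auto
    from conn_insertD[OF this] no
    have "conn ?B c a \<and> conn ?B b d \<or> conn ?B c b \<and> conn ?B a d" by simp
    then have "conn A c a \<and> conn A b d \<or> conn A c b \<and> conn A a d"
      by (meson conn_mono Diff_subset)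
    then have "conn A a b" using conn_edge[OF cdA] conn_sym conn_trans by metis
    then show False using assms(2) by simp
  qed
qed

text \<open>The edges whose removal separates \<open>a\<close> from \<open>b\<close> form the unique path joining them
  in the forest.\<close>

lemma acyclic_edges_conn_by_separating:
  assumes "finite A" and "acyclic_edges A" and "conn A a b"
  shows "conn {f \<in> A. \<not> conn (A - {f}) a b} a b"
proof -
  \<comment> \<open>A smallest subset \<open>C\<close> of \<open>A\<close> joining \<open>a\<close>
    to \<open>b\<close> is the path. Each \<open>f\<close> in \<open>C\<close> is a bridge within
    \<open>C\<close>; a connection of \<open>a\<close> and \<open>b\<close> in
    \<open>A - {f}\<close> would therefore link the ends of \<open>f\<close> without
    \<open>f\<close>, against acyclicity.\<close>
  define P where "P C \<longleftrightarrow> C \<subseteq> A \<and> conn C a b" for C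
  have "P A" using assms(3) by (simp add: P_def)
  then obtain C where C: "P C" and min: "\<And>D. P D \<Longrightarrow> card C \<le> card D"
    using ex_has_least_nat[of P A card] by blast
  have finC: "finite C" using C assms(1) finite_subset unfolding P_def by blast
  have "\<not> conn (A - {f}) a b" if f: "f \<in> C" for f
  proof
    assume contra: "conn (A - {f}) a b"
    have "\<not> conn (C - {f}) a b"
    proof
      assume "conn (C - {f}) a b"
      then have "card C \<le> card (C - {f})" using C by (intro min) (auto simp: P_def)
      then show False using f finC by (metis card_Diff1_less not_le)
    qed
    then obtain x y where xy: "f = {x, y}" "conn (C - {f}) a x" "conn (C - {f}) y b"
      using C conn_bridge unfolding P_def by metis
    have sub: "C - {f} \<subseteq> A - {f}" using C by (auto simp: P_def)
    have "conn (A - {f}) x y"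
      using conn_mono[OF xy(2) sub] conn_mono[OF xy(3) sub] contra conn_sym conn_trans by metis
    moreover have "{x, y} \<in> A" using f C xy(1) by (auto simp: P_def)
    ultimately show False using assms(2) xy(1) by (simp add: acyclic_edges_def)
  qed
  then show ?thesis using C conn_mono[of C a b] unfolding P_def by (simp add: subset_iff)
qed

section \<open>Connectivity classes and their number in a forest\<close>

definition conn_class :: "'a set \<Rightarrow> 'a set set \<Rightarrow> 'a \<Rightarrow> 'a set" where
  "conn_class V A x = {y \<in> V. conn A x y}"

definition conn_classes :: "'a set \<Rightarrow> 'a set set \<Rightarrow> 'a set set" where
  "conn_classes V A = conn_class V A ` V"

lemma conn_class_self: "x \<in> V \<Longrightarrow> x \<in> conn_class V A x"
  by (simp add: conn_class_def)

lemma conn_class_eq_iff: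
  assumes "y \<in> V"
  shows "conn_class V A x = conn_class V A y \<longleftrightarrow> conn A x y"
proof
  assume "conn_class V A x = conn_class V A y"
  then have "y \<in> conn_class V A x" using assms by (simp add: conn_class_self)
  then show "conn A x y" by (simp add: conn_class_def)
next
  assume "conn A x y"
  then have "conn A x z \<longleftrightarrow> conn A y z" for z using conn_sym conn_trans by metis
  then show "conn_class V A x = conn_class V A y" by (simp add: conn_class_def)
qed

lemma partition_on_conn_classes: "partition_on V (conn_classes V A)"
proof (rule partition_onI)
  show "\<Union> (conn_classes V A) = V"
    by (auto simp: conn_classes_def conn_class_def)
next
  show "{} \<notin> conn_classes V A"
    using conn_class_self by (fastforce simp: conn_classes_def)
next
  fix X Y assume XY: "X \<in> conn_classes V A" "Y \<in> conn_classes V A" "X \<noteq> Y"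
  then obtain x y where x: "X = conn_class V A x" "x \<in> V" and y: "Y = conn_class V A y" "y \<in> V"
    by (auto simp: conn_classes_def)
  show "disjnt X Y"
  proof (rule ccontr)
    assume "\<not> disjnt X Y"
    then obtain z where "conn A x z" "conn A y z"
      by (auto simp: disjnt_def x y conn_class_def)
    then have "conn A x y" using conn_sym conn_trans by metis
    then show False using XY(3) x y conn_class_eq_iff by metis
  qed
qed

text \<open>Starting from singleton classes, each edge of a forest joins two different classes and
  so lowers their number by exactly one.\<close>

lemma card_conn_classes:
  assumes "finite V" and "finite A" and "acyclic_edges A"
    and "\<And>e. e \<in> A \<Longrightarrow> e \<subseteq> V \<and> card e = 2"
  shows "card (conn_classes V A) + card A = card V"
  using assms(2-)
proof (induction A rule: finite_induct)
  case empty
  have "conn {} x y \<longleftrightarrow> x = y" for x y :: 'a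
    unfolding conn_def by (auto elim: rtranclp.cases)
  then have "inj_on (conn_class V {}) V"
    by (auto simp: inj_on_def conn_class_eq_iff)
  then show ?case by (simp add: conn_classes_def card_image)
next
  case (insert e A)
  have ac: "acyclic_edges A" by (rule acyclic_edges_subset[OF insert.prems(1)]) auto
  obtain a b where e: "e = {a, b}" using insert.prems(2)[of e] by (auto simp: card_2_iff)
  have ab: "a \<in> V" "b \<in> V" using insert.prems(2)[of e] e by auto
  have nconn: "\<not> conn A a b"
    using insert.prems(1) insert.hyps(2) unfolding acyclic_edges_def e
    by (metis Diff_insert_absorb insertI1)
  let ?c = "conn_class V A" and ?c' = "conn_class V (insert e A)"
  have conn': "conn (insert e A) x y \<longleftrightarrow>
      conn A x y \<or> conn A x a \<and> conn A b y \<or> conn A x b \<and> conn A a y" for x y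
  proof
    have "conn (insert e A) a b" "conn (insert e A) b a"
      by (auto intro!: conn_edge simp: e insert_commute)
    moreover have "conn (insert e A) p q" if "conn A p q" for p q
      using that by (rule conn_mono) auto
    moreover assume "conn A x y \<or> conn A x a \<and> conn A b y \<or> conn A x b \<and> conn A a y"
    ultimately show "conn (insert e A) x y" using conn_trans by metis
  qed (use conn_insertD e in metis)
  \<comment> \<open>The classes of \<open>a\<close> and \<open>b\<close> merge, all others stay as
    they were.\<close>
  have cls: "?c' x = (if conn A x a \<or> conn A x b then ?c a \<union> ?c b else ?c x)" for x
  proof -
    have "conn (insert e A) x y \<longleftrightarrow>
        (if conn A x a \<or> conn A x b then conn A a y \<or> conn A b y else conn A x y)" for y
      unfolding conn' using conn_sym conn_trans by metis
    then show ?thesis by (auto simp: conn_class_def)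
  qed
  let ?R = "conn_classes V A - {?c a, ?c b}"
  have new: "conn_classes V (insert e A) = insert (?c a \<union> ?c b) ?R"
  proof (intro subset_antisym subsetI)
    fix X assume "X \<in> conn_classes V (insert e A)"
    then obtain x where x: "x \<in> V" "X = ?c' x" by (auto simp: conn_classes_def)
    then show "X \<in> insert (?c a \<union> ?c b) ?R"
      using ab by (auto simp: cls conn_classes_def conn_class_eq_iff)
  next
    fix X assume "X \<in> insert (?c a \<union> ?c b) ?R"
    then consider "X = ?c a \<union> ?c b" | x where "x \<in> V" "X = ?c x" "?c x \<noteq> ?c a" "?c x \<noteq> ?c b"
      by (auto simp: conn_classes_def)
    then show "X \<in> conn_classes V (insert e A)"
    proof cases
      case 1
      then have "X = ?c' a" by (simp add: cls)
      then show ?thesis using ab by (simp add: conn_classes_def)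
    next
      case 2
      then have "X = ?c' x" using ab by (simp add: cls conn_class_eq_iff)
      then show ?thesis using 2 by (simp add: conn_classes_def)
    qed
  qed
  \<comment> \<open>The merged class is not an old one, so two classes disappear and one
    appears.\<close>
  have "?c a \<union> ?c b \<notin> ?R"
  proof
    assume "?c a \<union> ?c b \<in> ?R"
    then obtain x where x: "x \<in> V" "?c a \<union> ?c b = ?c x" "?c x \<noteq> ?c a"
      by (auto simp: conn_classes_def)
    have "a \<in> ?c x" using x(2) conn_class_self[OF ab(1)] by blast
    then show False using x(3) ab conn_class_eq_iff[of a V A x] by (simp add: conn_class_def)
  qed
  moreover have fin: "finite (conn_classes V A)" using assms(1) by (simp add: conn_classes_def)
  ultimately have "card (conn_classes V (insert e A)) = Suc (card ?R)" by (simp add: new)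
  moreover have "card ?R = card (conn_classes V A) - 2" "card (conn_classes V A) \<ge> 2"
  proof -
    have sub: "{?c a, ?c b} \<subseteq> conn_classes V A" using ab by (auto simp: conn_classes_def)
    moreover have two: "card {?c a, ?c b} = 2" using nconn ab by (simp add: conn_class_eq_iff)
    ultimately show "card ?R = card (conn_classes V A) - 2" by (simp add: card_Diff_subset)
    show "card (conn_classes V A) \<ge> 2" using card_mono[OF fin sub] two by simp
  qed
  moreover have "card (conn_classes V A) + card A = card V"
    using insert.IH ac insert.prems(2) by simp
  ultimately show ?case using insert.hyps by simp
qed

section \<open>Packing spanning trees\<close>

text \<open>The forests may be empty, so a packing always exists and one of maximum size can be
  chosen. Only the values of \<open>F\<close> below \<open>K\<close> matter.\<close>

definition forest_packing :: "'a set set \<Rightarrow> nat \<Rightarrow> (nat \<Rightarrow> 'a set set) \<Rightarrow> bool" where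
  "forest_packing E K F \<longleftrightarrow> (\<forall>i<K. F i \<subseteq> E \<and> acyclic_edges (F i)) \<and>
     (\<forall>i<K. \<forall>j<K. i \<noteq> j \<longrightarrow> F i \<inter> F j = {})"

definition packing_size :: "nat \<Rightarrow> (nat \<Rightarrow> 'a set set) \<Rightarrow> nat" where
  "packing_size K F = (\<Sum>i<K. card (F i))"

text \<open>An uncovered edge \<open>{a, b}\<close> enters \<open>F i\<close> in place of
  \<open>f\<close>. The last premise keeps \<open>F i\<close> acyclic; in a maximum packing it says
  that \<open>f\<close> lies on the path of \<open>F i\<close> from \<open>a\<close> to
  \<open>b\<close>.\<close>

inductive exchange :: "'a set set \<Rightarrow> nat \<Rightarrow> (nat \<Rightarrow> 'a set set) \<Rightarrow> (nat \<Rightarrow> 'a set set) \<Rightarrow> bool"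
  for E K where
  "i < K \<Longrightarrow> {a, b} \<in> E \<Longrightarrow> \<forall>j<K. {a, b} \<notin> F j \<Longrightarrow> f \<in> F i \<Longrightarrow> \<not> conn (F i - {f}) a b \<Longrightarrow>
     exchange E K F (F(i := insert {a, b} (F i - {f})))"

text \<open>The set \<open>S\<close> of the overview. Zero exchanges are allowed, so every edge of
  \<open>E\<close> left uncovered by \<open>F\<close> itself belongs to it.\<close>

definition exposable :: "'a set set \<Rightarrow> nat \<Rightarrow> (nat \<Rightarrow> 'a set set) \<Rightarrow> 'a set set" where
  "exposable E K F = {e \<in> E. \<exists>F'. (exchange E K)\<^sup>*\<^sup>* F F' \<and> (\<forall>i<K. e \<notin> F' i)}"

lemma exchange_forest_packing:
  assumes "exchange E K F F'" and "finite E" and "forest_packing E K F"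
  shows "forest_packing E K F' \<and> packing_size K F' = packing_size K F"
  using assms(1)
proof cases
  case (1 i a b f)
  have sub: "F j \<subseteq> E" and ac: "acyclic_edges (F j)" if "j < K" for j
    using assms(3) that by (auto simp: forest_packing_def)
  have dis: "F j \<inter> F l = {}" if "j < K" "l < K" "j \<noteq> l" for j l
    using assms(3) that by (auto simp: forest_packing_def)
  let ?I = "insert {a, b} (F i - {f})"
  have "acyclic_edges (F i - {f})"
    by (rule acyclic_edges_subset[OF ac[OF 1(2)]]) auto
  then have "acyclic_edges ?I" using 1(6) by (rule acyclic_edges_insert)
  moreover have "?I \<subseteq> E" using sub[OF 1(2)] 1(3) by auto
  moreover have "?I \<inter> F j = {}" if "j < K" "j \<noteq> i" for j
    using dis[of i j] 1(2,4) that by auto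
  ultimately have "forest_packing E K F'"
    using assms(3) unfolding 1(1) forest_packing_def
    by (auto simp del: Int_insert_left Int_insert_right simp: Int_commute)
  moreover have "card (F' j) = card (F j)" if "j < K" for j
  proof (cases "j = i")
    case True
    have "finite (F i)" using sub[OF 1(2)] assms(2) finite_subset by blast
    then have "card ?I = card (F i)"
      using 1(2,4,5) card_Suc_Diff1 by fastforce
    then show ?thesis using True by (simp add: 1(1))
  qed (simp add: 1(1))
  ultimately show ?thesis by (simp add: packing_size_def)
qed

text \<open>Each exchange swaps one edge for another. Hence every packing reachable from a maximum
  one is again maximum.\<close>

lemma reachable_forest_packing:
  assumes "(exchange E K)\<^sup>*\<^sup>* F F'" and "finite E" and "forest_packing E K F"
  shows "forest_packing E K F' \<and> packing_size K F' = packing_size K F"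
  using assms(1)
  by (induction rule: rtranclp_induct) (use assms exchange_forest_packing in auto)

text \<open>Otherwise the uncovered edge could be added to \<open>F i\<close>, giving a larger
  packing.\<close>

lemma maximum_packing_spans_uncovered:
  assumes "finite E" and "forest_packing E K F"
    and max: "\<And>F'. forest_packing E K F' \<Longrightarrow> packing_size K F' \<le> packing_size K F"
    and "{a, b} \<in> E" and unc: "\<forall>j<K. {a, b} \<notin> F j" and "i < K"
  shows "conn (F i) a b"
proof (rule ccontr)
  assume no: "\<not> conn (F i) a b"
  let ?F = "F(i := insert {a, b} (F i))"
  have "acyclic_edges (insert {a, b} (F i))"
    using assms(2,6) no by (intro acyclic_edges_insert) (auto simp: forest_packing_def)
  then have "forest_packing E K ?F"
    using assms(2,4,5,6) unfolding forest_packing_def by auto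
  then have "packing_size K ?F \<le> packing_size K F" by (rule max)
  moreover have "packing_size K ?F = Suc (packing_size K F)"
  proof -
    have "F i \<subseteq> E" using assms(2,6) by (simp add: forest_packing_def)
    then have "finite (F i)" using assms(1) by (rule finite_subset)
    then have "card (?F i) = Suc (card (F i))" using unc assms(6) by simp
    moreover have "(\<Sum>j\<in>{..<K} - {i}. card (?F j)) = (\<Sum>j\<in>{..<K} - {i}. card (F j))"
      by (rule sum.cong) auto
    ultimately show ?thesis
      using assms(6) by (simp add: packing_size_def sum.remove[of "{..<K}" i])
  qed
  ultimately show False by simp
qed

text \<open>Every edge of the path that \<open>{a, b}\<close> closes in \<open>F' i\<close> can be exchanged for \<open>{a, b}\<close>, so
  this path consists of exposable edges.\<close>

lemma exposable_spans_uncovered: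
  assumes "finite E" and "forest_packing E K F"
    and max: "\<And>F'. forest_packing E K F' \<Longrightarrow> packing_size K F' \<le> packing_size K F"
    and reach: "(exchange E K)\<^sup>*\<^sup>* F F'"
    and ab: "{a, b} \<in> E" and unc: "\<forall>j<K. {a, b} \<notin> F' j" and i: "i < K"
  shows "conn (F' i \<inter> exposable E K F) a b"
proof -
  have F': "forest_packing E K F'" and size: "packing_size K F' = packing_size K F"
    using reachable_forest_packing[OF reach assms(1,2)] by auto
  have sub: "F' i \<subseteq> E" and ac: "acyclic_edges (F' i)" using F' i by (auto simp: forest_packing_def)
  have "conn (F' i) a b"
    using maximum_packing_spans_uncovered[OF assms(1) F' _ ab unc i] max size by simp
  moreover have "finite (F' i)" using sub assms(1) finite_subset by blast
  ultimately have path: "conn {f \<in> F' i. \<not> conn (F' i - {f}) a b} a b"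
    using ac by (intro acyclic_edges_conn_by_separating)
  have "f \<in> exposable E K F" if f: "f \<in> F' i" "\<not> conn (F' i - {f}) a b" for f
  proof -
    let ?F = "F'(i := insert {a, b} (F' i - {f}))"
    have "exchange E K F' ?F" using i ab unc f by (rule exchange.intros)
    with reach have "(exchange E K)\<^sup>*\<^sup>* F ?F" by simp
    moreover have "f \<notin> F' j" if "j < K" "j \<noteq> i" for j
      using F' i that f(1) unfolding forest_packing_def by blast
    moreover have "f \<noteq> {a, b}" using f(1) unc i by blast
    ultimately have "(exchange E K)\<^sup>*\<^sup>* F ?F \<and> (\<forall>j<K. f \<notin> ?F j)" by simp
    moreover have "f \<in> E" using f(1) sub by blast
    ultimately show ?thesis unfolding exposable_def by blast
  qed
  then show ?thesis using path by (elim conn_mono) auto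
qed

text \<open>Within the exposable edges, an exchange adds \<open>{a, b}\<close> and removes an edge
  of the path that already joins \<open>a\<close> to \<open>b\<close> there. Both edges lie on one
  cycle, so the components do not change.\<close>

lemma exchange_conn_exposable:
  assumes "finite E" and "forest_packing E K F"
    and max: "\<And>F'. forest_packing E K F' \<Longrightarrow> packing_size K F' \<le> packing_size K F"
    and reach: "(exchange E K)\<^sup>*\<^sup>* F F'" and l: "l < K"
  shows "conn (F' l \<inter> exposable E K F) u v \<longleftrightarrow> conn (F l \<inter> exposable E K F) u v"
  using reach
proof (induction rule: rtranclp_induct)
  case (step F' F'')
  let ?S = "exposable E K F"
  from step(2) have "conn (F'' l \<inter> ?S) u v \<longleftrightarrow> conn (F' l \<inter> ?S) u v"
  proof cases
    case (1 i a b f)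
    show ?thesis
    proof (cases "l = i")
      case True
      let ?X = "F' i \<inter> ?S" and ?Y = "F'' i \<inter> ?S"
      have conn_ab: "conn ?X a b"
        using exposable_spans_uncovered[OF assms(1-3) step(1)] 1 by blast
      have "{a, b} \<in> ?S" using 1 step(1) by (auto simp: exposable_def)
      then have Y: "?Y = insert {a, b} (?X - {f})" by (auto simp: 1(1))
      have "\<not> conn (?X - {f}) a b"
        using 1(6) conn_mono[of "?X - {f}" a b "F' i - {f}"] by blast
      then obtain x y where xy: "f = {x, y}" "conn (?X - {f}) a x" "conn (?X - {f}) y b"
        using conn_bridge[OF conn_ab] by metis
      have mono: "conn ?Y p q" if "conn (?X - {f}) p q" for p q
        using that by (rule conn_mono) (auto simp: Y)
      have "conn ?Y a b" by (rule conn_edge) (simp add: Y)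
      \<comment> \<open>The removed edge \<open>f\<close> is bypassed along the rest of the cycle:
        from \<open>x\<close> to \<open>a\<close>, over the new edge to \<open>b\<close>, and on to
        \<open>y\<close>.\<close>
      then have xy_Y: "conn ?Y x y"
        using mono[OF xy(2)] mono[OF xy(3)] conn_sym conn_trans by metis
      have "conn ?X p q" if "{p, q} \<in> ?Y" for p q
      proof (cases "{p, q} = {a, b}")
        case True
        then show ?thesis using conn_ab conn_sym by (metis doubleton_eq_iff)
      next
        case False
        then show ?thesis using that by (intro conn_edge) (auto simp: Y)
      qed
      moreover have "conn ?Y p q" if "{p, q} \<in> ?X" for p q
      proof (cases "{p, q} = f")
        case True
        then show ?thesis using xy_Y xy(1) conn_sym by (metis doubleton_eq_iff)
      next
        case False
        then show ?thesis using that by (intro conn_edge) (auto simp: Y)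
      qed
      ultimately have "conn ?Y u v \<longleftrightarrow> conn ?X u v" using conn_by_edges by meson
      then show ?thesis using True by simp
    qed (simp add: 1(1))
  qed
  then show ?case using step.IH by simp
qed simp

section \<open>Maximum packings and the partition condition\<close>

lemma maximum_forest_packing_exists:
  assumes "finite E"
  obtains F where "forest_packing E K F"
    and "\<And>F'. forest_packing E K F' \<Longrightarrow> packing_size K F' \<le> packing_size K F"
proof -
  have "packing_size K F \<le> K * card E" if "forest_packing E K F" for F
  proof -
    have "packing_size K F \<le> (\<Sum>i<K. card E)" unfolding packing_size_def
      using that assms by (intro sum_mono card_mono) (auto simp: forest_packing_def)
    then show ?thesis by simp
  qed
  moreover have "forest_packing E K (\<lambda>_. {})" by (simp add: forest_packing_def acyclic_edges_def)
  ultimately show thesis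
    using that ex_has_greatest_nat[of "forest_packing E K" _ "packing_size K" "Suc (K * card E)"]
    unfolding less_Suc_eq_le by blast
qed

text \<open>The hypothesis is applied to the components of \<open>S\<close>. Each \<open>F i\<close>
  has \<open>card V - card P\<close> edges in \<open>S\<close>, and the edges crossing
  \<open>P\<close> all lie in forests and outside \<open>S\<close>. Together the forests have at
  least \<open>K * (card V - 1)\<close> edges, the most that \<open>K\<close> forests can have, so
  each is a spanning tree.\<close>

theorem forest_packing_of_partition_condition:
  fixes V :: "'a set" and E :: "'a set set"
  assumes V: "finite V" "V \<noteq> {}" and E: "\<And>e. e \<in> E \<Longrightarrow> e \<subseteq> V \<and> card e = 2"
    and cond: "\<And>P. partition_on V P \<Longrightarrow> K * (card P - 1) \<le> card {e \<in> E. \<forall>X\<in>P. \<not> e \<subseteq> X}"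
  obtains F where "forest_packing E K F" "\<And>i. i < K \<Longrightarrow> card (F i) = card V - 1"
    and "\<And>i u v. i < K \<Longrightarrow> u \<in> V \<Longrightarrow> v \<in> V \<Longrightarrow> conn (F i) u v"
proof -
  have finE: "finite E" using E V(1) by (intro finite_subset[of E "Pow V"]) auto
  obtain F where F: "forest_packing E K F"
    and max: "\<And>F'. forest_packing E K F' \<Longrightarrow> packing_size K F' \<le> packing_size K F"
    using maximum_forest_packing_exists[OF finE] by blast
  define S where "S = exposable E K F"
  let ?P = "conn_classes V S"
  have sub: "F i \<subseteq> E" and ac: "acyclic_edges (F i)" if "i < K" for i
    using F that by (auto simp: forest_packing_def)
  have fin: "finite (F i)" if "i < K" for i using sub[OF that] finE finite_subset by blast
  have P0: "card (conn_classes V A) \<ge> 1" for A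
    using V by (simp add: conn_classes_def Suc_le_eq card_gt_0_iff)
  have cardF: "card (conn_classes V (F i)) + card (F i) = card V" if "i < K" for i
    using that sub E by (intro card_conn_classes V fin ac) auto
  have cardS: "card ?P + card (F i \<inter> S) = card V" if i: "i < K" for i
  proof -
    \<comment> \<open>The ends of an exposable edge are joined in the packing \<open>F'\<close> that
      leaves it uncovered; invariance under exchanges carries this back to \<open>F\<close>.\<close>
    have "conn (F i \<inter> S) a b" if "{a, b} \<in> S" for a b
    proof -
      have abE: "{a, b} \<in> E" and "\<exists>F'. (exchange E K)\<^sup>*\<^sup>* F F' \<and> (\<forall>j<K. {a, b} \<notin> F' j)"
        using that by (simp_all add: S_def exposable_def)
      then obtain F' where F': "(exchange E K)\<^sup>*\<^sup>* F F'" "\<forall>j<K. {a, b} \<notin> F' j"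
        by (elim exE conjE)
      have "conn (F' i \<inter> S) a b"
        using exposable_spans_uncovered[OF finE F max F'(1) abE F'(2) i] by (simp add: S_def)
      then show ?thesis
        using exchange_conn_exposable[OF finE F max F'(1) i] by (simp add: S_def)
    qed
    then have "conn (F i \<inter> S) u v \<longleftrightarrow> conn S u v" for u v
      using conn_by_edges[of S u v "F i \<inter> S"] conn_mono[of "F i \<inter> S" u v S] by blast
    then have "conn_classes V (F i \<inter> S) = ?P"
      by (simp add: conn_classes_def conn_class_def[abs_def])
    moreover have "card (conn_classes V (F i \<inter> S)) + card (F i \<inter> S) = card V"
      using i sub E fin ac acyclic_edges_subset[of "F i" "F i \<inter> S"]
      by (intro card_conn_classes V) auto
    ultimately show ?thesis by simp
  qed
  \<comment> \<open>An exposable edge lies inside a component of \<open>S\<close>. A crossing edge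
    is therefore not exposable, and in particular \<open>F\<close> covers it.\<close>
  have "{e \<in> E. \<forall>X\<in>?P. \<not> e \<subseteq> X} \<subseteq> (\<Union>i<K. F i - S)"
  proof
    fix e assume "e \<in> {e \<in> E. \<forall>X\<in>?P. \<not> e \<subseteq> X}"
    then have e: "e \<in> E" "\<And>X. X \<in> ?P \<Longrightarrow> \<not> e \<subseteq> X" by auto
    obtain a b where ab: "e = {a, b}" "a \<in> V" "b \<in> V" using E[OF e(1)] by (auto simp: card_2_iff)
    have "e \<notin> S"
    proof
      assume "e \<in> S"
      then have "e \<subseteq> conn_class V S a" using ab by (auto simp: conn_class_def conn_edge)
      then show False using e(2) ab by (auto simp: conn_classes_def)
    qed
    moreover have "\<exists>i<K. e \<in> F i"
      using calculation e(1) unfolding S_def exposable_def by blast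
    ultimately show "e \<in> (\<Union>i<K. F i - S)" by blast
  qed
  then have "card {e \<in> E. \<forall>X\<in>?P. \<not> e \<subseteq> X} \<le> card (\<Union>i<K. F i - S)"
    by (intro card_mono) (auto simp: fin)
  also have "\<dots> \<le> (\<Sum>i<K. card (F i - S))" by (rule card_UN_le) simp
  finally have "K * (card ?P - 1) \<le> (\<Sum>i<K. card (F i - S))"
    using cond[OF partition_on_conn_classes] by (rule le_trans[rotated])
  moreover have "card (F i - S) + (card V - card ?P) = card (F i)" if "i < K" for i
    using card_Int_Diff[OF fin[OF that], of S] cardS[OF that] by simp
  then have "(\<Sum>i<K. card (F i - S) + (card V - card ?P)) = (\<Sum>i<K. card (F i))" by simp
  then have "(\<Sum>i<K. card (F i - S)) + K * (card V - card ?P) = (\<Sum>i<K. card (F i))"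
    by (simp add: sum.distrib)
  moreover have "card ?P \<le> card V" using V(1) by (simp add: conn_classes_def card_image_le)
  then have "K * (card ?P - 1) + K * (card V - card ?P) = K * (card V - 1)"
    using P0[of S] by (simp flip: add_mult_distrib2)
  ultimately have total: "K * (card V - 1) \<le> (\<Sum>i<K. card (F i))" by linarith
  have le: "card (F i) \<le> card V - 1" if "i < K" for i using cardF[OF that] P0[of "F i"] by simp
  have full: "card (F i) = card V - 1" if i: "i < K" for i
  proof (rule ccontr)
    assume "card (F i) \<noteq> card V - 1"
    then have "(\<Sum>i<K. card (F i)) < (\<Sum>i<K. card V - 1)"
      using le i by (intro sum_strict_mono_ex1) (auto simp: nat_less_le)
    then show False using total by simp
  qed
  show thesis
  proof (rule that[OF F full])
    fix i u v assume i: "i < K" and uv: "u \<in> V" "v \<in> V"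
    have "card V > 0" using V by (simp add: card_gt_0_iff)
    then have "card (conn_classes V (F i)) = 1" using cardF[OF i] full[OF i] by simp
    moreover have "conn_class V (F i) u \<in> conn_classes V (F i)"
      "conn_class V (F i) v \<in> conn_classes V (F i)" using uv by (auto simp: conn_classes_def)
    ultimately have "conn_class V (F i) u = conn_class V (F i) v" by (auto simp: card_1_singleton_iff)
    then show "conn (F i) u v" using conn_class_eq_iff[OF uv(2)] by metis
  qed
qed

section \<open>From edge sets to spanning trees\<close>

lemma path_of_conn:
  assumes "conn (edges G) u v" and "u \<in> verts G" and "\<And>e. e \<in> edges G \<Longrightarrow> e \<subseteq> verts G"
  shows "\<exists>p. path_between G u p v"
  using assms(1) unfolding conn_def
proof (induction rule: rtranclp_induct)
  case base
  have "path_between G u [u] u" using assms(2) by (simp add: path_between_def is_path_def)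
  then show ?case by blast
next
  case (step y z)
  then obtain p where p: "p \<noteq> []" "distinct p" "set p \<subseteq> verts G"
    "successively (\<lambda>u v. {u, v} \<in> edges G) p" "hd p = u" "last p = y"
    by (auto simp: path_between_def is_path_def)
  show ?case
  proof (cases "z \<in> set p")
    case True
    \<comment> \<open>The walk returns to a vertex of the path, so the path is cut off
      there.\<close>
    then obtain q r where qr: "p = q @ z # r" by (meson split_list)
    have "path_between G u (q @ [z]) z"
      using p by (auto simp: qr path_between_def is_path_def successively_append_iff hd_append)
    then show ?thesis by blast
  next
    case False
    have "path_between G u (p @ [z]) z"
      using p False step(2) assms(3)[OF step(2)]
      by (auto simp: path_between_def is_path_def successively_append_iff)
    then show ?thesis by blast
  qed
qed

lemma successively_conn:
  assumes "successively (\<lambda>u v. {u, v} \<in> A) p" and "p \<noteq> []"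
  shows "conn A (hd p) (last p)"
  using assms
proof (induction p rule: induct_list012)
  case (3 x y zs)
  then show ?case using conn_edge[of x y A] conn_trans[of A x y] by simp
qed auto

text \<open>The edge closing a cycle is not a bridge: the remaining edges of the cycle join its
  ends.\<close>

lemma forest_of_acyclic_edges:
  assumes "simple_graph G" and "acyclic_edges (edges G)"
  shows "forest G"
  unfolding forest_def
proof (intro conjI assms(1) notI)
  assume "\<exists>c. is_cycle G c"
  then obtain c where c: "distinct c" "successively (\<lambda>u v. {u, v} \<in> edges G) c" "length c \<ge> 3"
    "{last c, hd c} \<in> edges G" by (auto simp: is_cycle_def is_path_def)
  let ?e = "{last c, hd c}"
  have ne: "c \<noteq> []" using c(3) by auto
  have "successively (\<lambda>u v. {u, v} \<in> edges G - {?e}) c"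
    unfolding successively_conv_nth
  proof (intro allI impI)
    fix i assume i: "Suc i < length c"
    \<comment> \<open>At least three vertices are required here: on two vertices the only path edge
      would be the closing edge itself.\<close>
    have "{c ! i, c ! Suc i} \<noteq> ?e"
    proof
      assume "{c ! i, c ! Suc i} = ?e"
      then have "c ! i = c ! (length c - 1) \<and> c ! Suc i = c ! 0 \<or>
                 c ! i = c ! 0 \<and> c ! Suc i = c ! (length c - 1)"
        using ne by (auto simp: doubleton_eq_iff last_conv_nth hd_conv_nth)
      moreover have "c ! p = c ! q \<longleftrightarrow> p = q" if "p < length c" "q < length c" for p q
        using c(1) that by (rule nth_eq_iff_index_eq)
      moreover have "0 < length c" "length c - 1 < length c" "i < length c" using i by auto
      ultimately have "i = length c - 1 \<and> Suc i = 0 \<or> i = 0 \<and> Suc i = length c - 1"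
        using i by metis
      then show False using c(3) by linarith
    qed
    then show "{c ! i, c ! Suc i} \<in> edges G - {?e}"
      using c(2) i by (simp add: successively_conv_nth)
  qed
  then have "conn (edges G - {?e}) (last c) (hd c)"
    using successively_conn ne conn_sym by metis
  then show False using assms(2) c(4) by (simp add: acyclic_edges_def)
qed

text \<open>The sufficiency part of the tree packing theorem of Nash-Williams and Tutte.\<close>

theorem spanning_tree_packing:
  assumes G: "simple_graph G" "verts G \<noteq> {}"
    and cond: "\<And>P. partition_on (verts G) P \<Longrightarrow>
      K * (card P - 1) \<le> card {e \<in> edges G. \<forall>X\<in>P. \<not> e \<subseteq> X}"
  obtains T where "\<And>i. i < K \<Longrightarrow> spanning_tree (T i) G"
    and "\<And>i. i < K \<Longrightarrow> card (edges (T i)) = order_graph G - 1"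
    and "\<And>i j. i < K \<Longrightarrow> j < K \<Longrightarrow> i \<noteq> j \<Longrightarrow> edge_disjoint (T i) (T j)"
proof -
  have fin: "finite (verts G)" and E: "\<And>e. e \<in> edges G \<Longrightarrow> e \<subseteq> verts G \<and> card e = 2"
    using G(1) by (auto simp: simple_graph_def)
  obtain F where F: "forest_packing (edges G) K F"
    and card: "\<And>i. i < K \<Longrightarrow> card (F i) = card (verts G) - 1"
    and conn: "\<And>i u v. i < K \<Longrightarrow> u \<in> verts G \<Longrightarrow> v \<in> verts G \<Longrightarrow> conn (F i) u v"
    using forest_packing_of_partition_condition[OF fin G(2) E cond] by metis
  define T where "T i = \<lparr>verts = verts G, edges = F i\<rparr>" for i
  have T: "verts (T i) = verts G" "edges (T i) = F i" for i by (simp_all add: T_def)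
  show thesis
  proof (rule that[of T])
    fix i assume i: "i < K"
    have sub: "F i \<subseteq> edges G" and ac: "acyclic_edges (F i)"
      using F i by (auto simp: forest_packing_def)
    have simple: "simple_graph (T i)" using sub E fin by (auto simp: simple_graph_def T)
    have "forest (T i)" using simple ac by (intro forest_of_acyclic_edges) (simp_all add: T)
    moreover have "connected_graph (T i)"
      unfolding connected_graph_def
    proof (intro conjI ballI)
      show "\<exists>p. path_between (T i) u p v" if "u \<in> verts (T i)" "v \<in> verts (T i)" for u v
      proof (rule path_of_conn)
        show "e \<subseteq> verts (T i)" if "e \<in> edges (T i)" for e
          using that E[of e] sub by (auto simp: T)
      qed (use that conn[OF i] in \<open>simp_all add: T\<close>)
    qed (use G(2) T in simp)
    ultimately show "spanning_tree (T i) G"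
      using simple sub by (simp add: spanning_tree_def tree_def subgraph_def T)
    show "card (edges (T i)) = order_graph G - 1" using card[OF i] by (simp add: T order_graph_def)
  next
    fix i j assume "i < K" "j < K" "i \<noteq> j"
    then show "edge_disjoint (T i) (T j)"
      using F by (auto simp: forest_packing_def edge_disjoint_def T)
  qed
qed

section \<open>Extremal eigenvalues of symmetric forms\<close>

text \<open>Vectors are functions vanishing outside \<open>V\<close>. The sphere is then a closed
  subset of a product of compact sets, \<open>{-1..1}\<close> on \<open>V\<close> and
  \<open>{0}\<close> elsewhere, and Tychonoff's theorem applies.\<close>

lemma compact_finite_dim_sphere:
  fixes V :: "'a set"
  assumes "finite V"
  shows "compact {f :: 'a \<Rightarrow> real. (\<forall>x. x \<notin> V \<longrightarrow> f x = 0) \<and> (\<Sum>v\<in>V. (f v)\<^sup>2) = 1}"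
    (is "compact ?S")
proof -
  let ?B = "\<lambda>x. if x \<in> V then {-1..1} else {0 :: real}"
  have "compactin (product_topology (\<lambda>_. euclidean) UNIV) (PiE UNIV ?B)"
    by (subst compactin_PiE) (auto simp: compactin_euclidean_iff)
  then have "compact (PiE UNIV ?B)"
    by (simp add: euclidean_product_topology compactin_euclidean_iff)
  moreover have "closed {f :: 'a \<Rightarrow> real. (\<Sum>v\<in>V. (f v)\<^sup>2) = 1}"
    by (intro closed_Collect_eq continuous_intros continuous_on_product_coordinates)
  ultimately have "compact (PiE UNIV ?B \<inter> {f. (\<Sum>v\<in>V. (f v)\<^sup>2) = 1})"
    by (rule compact_Int_closed)
  moreover have "PiE UNIV ?B \<inter> {f. (\<Sum>v\<in>V. (f v)\<^sup>2) = 1} = ?S"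
  proof (intro equalityI subsetI)
    fix f assume "f \<in> PiE UNIV ?B \<inter> {f. (\<Sum>v\<in>V. (f v)\<^sup>2) = 1}"
    then show "f \<in> ?S" by (auto simp: PiE_iff split: if_splits)
  next
    fix f assume f: "f \<in> ?S"
    have "f v \<in> {-1..1}" if "v \<in> V" for v
    proof -
      have "(f v)\<^sup>2 \<le> (\<Sum>v\<in>V. (f v)\<^sup>2)" using assms that by (intro member_le_sum) auto
      then have "(f v)\<^sup>2 \<le> 1" using f by simp
      then show ?thesis by (simp add: abs_square_le_1 abs_le_iff)
    qed
    then show "f \<in> PiE UNIV ?B \<inter> {f. (\<Sum>v\<in>V. (f v)\<^sup>2) = 1}" using f by auto
  qed
  ultimately show ?thesis by simp
qed

text \<open>For small positive \<open>t\<close> a positive linear term outweighs the quadratic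
  one.\<close>

lemma quadratic_nonpos_imp_linear_zero:
  fixes R C :: real
  assumes "R \<ge> 0" and "\<And>t. 2 * t * R + t\<^sup>2 * C \<le> 0"
  shows "R = 0"
proof (rule ccontr)
  assume "R \<noteq> 0"
  then have R: "R > 0" using assms(1) by simp
  \<comment> \<open>This choice gives \<open>t * C >= - R\<close>, so that
    \<open>2 * R + t * C\<close> stays positive.\<close>
  define t where "t = R / (\<bar>C\<bar> + 1)"
  have t: "t > 0" using R by (simp add: t_def)
  have "t * (2 * R + t * C) \<le> 0" using assms(2)[of t] by (simp add: algebra_simps power2_eq_square)
  then have "2 * R + t * C \<le> 0" using t by (simp add: mult_le_0_iff)
  moreover have "t * C \<ge> - R"
  proof -
    have "t * C \<ge> t * (- (\<bar>C\<bar> + 1))" using t by (intro mult_left_mono) auto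
    moreover have "t * (- (\<bar>C\<bar> + 1)) = - R" by (simp add: t_def field_simps)
    ultimately show ?thesis by simp
  qed
  ultimately show False using R by simp
qed

text \<open>A maximiser of the form on the unit sphere is an eigenvector: otherwise moving it in the
  direction of the residual \<open>D f - \<mu> f\<close> would increase the Rayleigh quotient.\<close>

theorem symmetric_form_maximum_eigenvalue:
  fixes D :: "'a \<Rightarrow> 'a \<Rightarrow> real"
  assumes V: "finite V" "V \<noteq> {}" and sym: "\<And>u v. D u v = D v u"
  obtains \<mu> f where "\<exists>v\<in>V. f v \<noteq> 0" and "\<forall>u\<in>V. (\<Sum>v\<in>V. D u v * f v) = \<mu> * f u"
    and "\<And>g. (\<Sum>u\<in>V. \<Sum>v\<in>V. D u v * g u * g v) \<le> \<mu> * (\<Sum>v\<in>V. (g v)\<^sup>2)"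
proof -
  define Q where "Q g = (\<Sum>u\<in>V. \<Sum>v\<in>V. D u v * g u * g v)" for g
  define N where "N g = (\<Sum>v\<in>V. (g v)\<^sup>2)" for g :: "'a \<Rightarrow> real"
  define S where "S = {f :: 'a \<Rightarrow> real. (\<forall>x. x \<notin> V \<longrightarrow> f x = 0) \<and> N f = 1}"
  have comp: "compact S" unfolding S_def N_def by (rule compact_finite_dim_sphere[OF V(1)])
  obtain w where w: "w \<in> V" using V(2) by blast
  have "(\<lambda>x. if x = w then 1 else 0) \<in> S"
    using w V(1) by (auto simp: S_def N_def if_distrib[of "\<lambda>x. x\<^sup>2"] cong: if_cong)
  then have ne: "S \<noteq> {}" by blast
  have "continuous_on UNIV Q" unfolding Q_def
    by (intro continuous_intros continuous_on_product_coordinates)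
  then have "continuous_on S Q" by (rule continuous_on_subset) simp
  then obtain f where f: "f \<in> S" and max: "\<And>g. g \<in> S \<Longrightarrow> Q g \<le> Q f"
    using continuous_attains_sup[OF comp ne] by blast
  define \<mu> where "\<mu> = Q f"
  have Nf: "N f = 1" using f by (simp add: S_def)
  have bound: "Q g \<le> \<mu> * N g" for g
  proof (cases "N g = 0")
    case True
    then have "g v = 0" if "v \<in> V" for v
      using that V(1) by (simp add: N_def sum_nonneg_eq_0_iff)
    then show ?thesis using True by (simp add: Q_def)
  next
    case False
    then have pos: "N g > 0" using sum_nonneg[of V "\<lambda>v. (g v)\<^sup>2"] by (simp add: N_def order_less_le)
    let ?h = "\<lambda>x. if x \<in> V then g x / sqrt (N g) else 0"
    have "N ?h = N g / N g"
      using pos unfolding N_def[of ?h] by (simp add: power_divide N_def flip: sum_divide_distrib)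
    then have "?h \<in> S" using pos by (simp add: S_def)
    then have "Q ?h \<le> \<mu>" unfolding \<mu>_def by (rule max)
    moreover have "Q ?h = Q g / N g"
      unfolding Q_def sum_divide_distrib using pos by (intro sum.cong refl) simp
    ultimately show ?thesis using pos by (simp add: field_simps)
  qed
  define y where "y u = (\<Sum>v\<in>V. D u v * f v)" for u
  define r where "r u = y u - \<mu> * f u" for u
  \<comment> \<open>The constant terms cancel because \<open>f\<close> attains the bound. By
    symmetry the two cross terms agree, and the inner product of \<open>r\<close> with
    \<open>y - \<mu> f\<close> is \<open>N r\<close>; this gives the linear coefficient.\<close>
  have expand: "Q (\<lambda>v. f v + t * r v) - \<mu> * N (\<lambda>v. f v + t * r v) =
      2 * t * N r + t\<^sup>2 * (Q r - \<mu> * N r)" for t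
  proof -
    have cross1: "(\<Sum>u\<in>V. \<Sum>v\<in>V. D u v * r u * f v) = (\<Sum>u\<in>V. r u * y u)"
      by (simp add: y_def sum_distrib_left mult_ac)
    have "(\<Sum>u\<in>V. \<Sum>v\<in>V. D u v * f u * r v) = (\<Sum>v\<in>V. \<Sum>u\<in>V. D v u * r v * f u)"
      by (subst sum.swap) (simp add: sym mult_ac)
    then have cross2: "(\<Sum>u\<in>V. \<Sum>v\<in>V. D u v * f u * r v) = (\<Sum>u\<in>V. r u * y u)"
      using cross1 by simp
    have "Q (\<lambda>v. f v + t * r v) = Q f + t * (\<Sum>u\<in>V. \<Sum>v\<in>V. D u v * f u * r v)
        + t * (\<Sum>u\<in>V. \<Sum>v\<in>V. D u v * r u * f v) + t\<^sup>2 * Q r"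
      unfolding Q_def sum_distrib_left sum.distrib[symmetric]
      by (intro sum.cong refl) (simp add: algebra_simps power2_eq_square)
    moreover have "N (\<lambda>v. f v + t * r v) = N f + 2 * t * (\<Sum>u\<in>V. r u * f u) + t\<^sup>2 * N r"
      unfolding N_def sum_distrib_left sum.distrib[symmetric]
      by (intro sum.cong refl) (simp add: algebra_simps power2_eq_square)
    moreover have "(\<Sum>u\<in>V. r u * y u) = N r + \<mu> * (\<Sum>u\<in>V. r u * f u)"
      unfolding N_def sum_distrib_left sum.distrib[symmetric]
      by (intro sum.cong refl) (simp add: r_def algebra_simps power2_eq_square)
    ultimately show ?thesis
      unfolding cross1 cross2 Nf \<mu>_def[symmetric] by (simp only:) (simp add: algebra_simps)
  qed
  have "N r = 0"
  proof (rule quadratic_nonpos_imp_linear_zero)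
    show "N r \<ge> 0" by (simp add: N_def sum_nonneg)
    show "2 * t * N r + t\<^sup>2 * (Q r - \<mu> * N r) \<le> 0" for t
      using bound[of "\<lambda>v. f v + t * r v"] expand[of t] by simp
  qed
  then have "r u = 0" if "u \<in> V" for u
    using that V(1) by (simp add: N_def sum_nonneg_eq_0_iff)
  then have "\<forall>u\<in>V. (\<Sum>v\<in>V. D u v * f v) = \<mu> * f u" by (simp add: r_def y_def)
  moreover have "\<exists>v\<in>V. f v \<noteq> 0"
  proof (rule ccontr)
    assume "\<not> (\<exists>v\<in>V. f v \<noteq> 0)"
    then have "N f = 0" by (simp add: N_def)
    then show False using Nf by simp
  qed
  ultimately show thesis using that bound unfolding Q_def N_def by blast
qed

text \<open>A Collatz-Wielandt bound: the eigenvalue equation is read at a vertex \<open>u\<close>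
  where \<open>\<bar>f u\<bar> / x u\<close> attains its maximum \<open>M\<close>, and every other
  \<open>\<bar>f v\<bar>\<close> is replaced by the larger \<open>M * x v\<close>.\<close>

lemma nonneg_eigenvalue_le:
  fixes D :: "'a \<Rightarrow> 'a \<Rightarrow> real"
  assumes "finite V" and nonneg: "\<And>u v. D u v \<ge> 0" and pos: "\<And>v. v \<in> V \<Longrightarrow> x v > 0"
    and sub: "\<And>u. u \<in> V \<Longrightarrow> (\<Sum>v\<in>V. D u v * x v) \<le> c * x u"
    and f: "\<exists>v\<in>V. f v \<noteq> 0" and eig: "\<forall>u\<in>V. (\<Sum>v\<in>V. D u v * f v) = \<mu> * f u"
  shows "\<mu> \<le> c"
proof -
  have ne: "V \<noteq> {}" using f by blast
  define M where "M = Max ((\<lambda>v. \<bar>f v\<bar> / x v) ` V)"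
  have le: "\<bar>f v\<bar> \<le> M * x v" if "v \<in> V" for v
  proof -
    have "\<bar>f v\<bar> / x v \<le> M" unfolding M_def using that assms(1) by (intro Max_ge) auto
    then show ?thesis using pos[OF that] by (simp add: divide_le_eq)
  qed
  have "M \<in> (\<lambda>v. \<bar>f v\<bar> / x v) ` V" unfolding M_def using assms(1) ne by (intro Max_in) auto
  then obtain u where u: "u \<in> V" "M = \<bar>f u\<bar> / x u" by blast
  then have Mu: "\<bar>f u\<bar> = M * x u" using pos[OF u(1)] by simp
  obtain v where v: "v \<in> V" "f v \<noteq> 0" using f by blast
  have M0: "M > 0"
  proof (rule ccontr)
    assume "\<not> M > 0"
    then have "M * x v \<le> 0" using pos[OF v(1)] by (simp add: mult_le_0_iff)
    then show False using le[OF v(1)] v(2) by simp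
  qed
  have "\<mu> * \<bar>f u\<bar> \<le> \<bar>\<mu> * f u\<bar>" by (simp add: abs_mult mult_right_mono)
  also have "\<dots> = \<bar>\<Sum>v\<in>V. D u v * f v\<bar>" using eig u(1) by simp
  also have "\<dots> \<le> (\<Sum>v\<in>V. \<bar>D u v * f v\<bar>)" by (rule sum_abs)
  also have "\<dots> \<le> (\<Sum>v\<in>V. D u v * (M * x v))"
    using le nonneg by (intro sum_mono) (simp add: abs_mult mult_left_mono)
  also have "\<dots> = M * (\<Sum>v\<in>V. D u v * x v)" by (simp add: sum_distrib_left mult_ac)
  also have "\<dots> \<le> M * (c * x u)" using sub[OF u(1)] M0 by (intro mult_left_mono) auto
  finally have "\<mu> * (M * x u) \<le> c * (M * x u)" by (simp add: Mu mult_ac)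
  then show ?thesis using M0 pos[OF u(1)] by simp
qed

section \<open>The distance spectral radius\<close>

lemma path_between_rev: "path_between G u p v \<Longrightarrow> path_between G v (rev p) u"
  by (auto simp: path_between_def is_path_def successively_rev hd_rev last_rev insert_commute)

lemma distance_sym: "distance G u v = distance G v u"
proof -
  have "(\<exists>p. path_between G u p v \<and> path_length p = l) \<longleftrightarrow>
        (\<exists>p. path_between G v p u \<and> path_length p = l)" for l
    by (metis path_between_rev path_length_def length_rev)
  then show ?thesis by (simp add: distance_def)
qed

lemma distance_le: "path_between G u p v \<Longrightarrow> distance G u v \<le> path_length p"
  unfolding distance_def by (rule Least_le) blast

lemma distance_self: "u \<in> verts G \<Longrightarrow> distance G u u = 0"
  using distance_le[of G u "[u]" u] by (simp add: path_between_def is_path_def path_length_def)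

lemma distance_attained:
  assumes "connected_graph G" "u \<in> verts G" "v \<in> verts G"
  obtains p where "path_between G u p v" "path_length p = distance G u v"
proof -
  have "\<exists>p. path_between G u p v" using assms by (simp add: connected_graph_def)
  then have "\<exists>l p. path_between G u p v \<and> path_length p = l" by blast
  then have "\<exists>p. path_between G u p v \<and> path_length p = distance G u v"
    unfolding distance_def by (rule LeastI_ex)
  then show thesis using that by blast
qed

lemma distance_ge:
  assumes "connected_graph G" "u \<in> verts G" "v \<in> verts G" "u \<noteq> v"
  shows "distance G u v \<ge> (if {u, v} \<in> edges G then 1 else 2)"
proof -
  obtain p where p: "path_between G u p v" "path_length p = distance G u v"
    using distance_attained[OF assms(1-3)] .
  have "length p \<ge> 2" using p(1) assms(4)
    by (cases p; cases "tl p") (auto simp: path_between_def is_path_def)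
  moreover have "{u, v} \<in> edges G" if "length p = 2"
    using that p(1) by (auto simp: path_between_def is_path_def length_Suc_conv numeral_2_eq_2)
  ultimately have "length p \<ge> (if {u, v} \<in> edges G then 2 else 3)"
    by (cases "length p = 2") auto
  then show ?thesis using p(2) by (auto simp: path_length_def split: if_splits)
qed

lemma vertex_enum:
  assumes "finite (verts G)"
  shows "distinct (vertex_enum G)" "set (vertex_enum G) = verts G"
proof -
  have "\<exists>vs. distinct vs \<and> set vs = verts G" using finite_distinct_list[OF assms] by blast
  then have "distinct (vertex_enum G) \<and> set (vertex_enum G) = verts G"
    unfolding vertex_enum_def by (rule someI_ex)
  then show "distinct (vertex_enum G)" "set (vertex_enum G) = verts G" by auto
qed

text \<open>Eigenvectors are functions on the vertices, which removes the chosen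
  enumeration.\<close>

definition distance_eigenvalue :: "'a ugraph \<Rightarrow> real \<Rightarrow> bool" where
  "distance_eigenvalue G \<mu> \<longleftrightarrow> (\<exists>f. (\<exists>v\<in>verts G. f v \<noteq> 0) \<and>
     (\<forall>u\<in>verts G. (\<Sum>v\<in>verts G. real (distance G u v) * f v) = \<mu> * f u))"

lemma spectrum_distance_matrix:
  assumes "finite (verts G)"
  shows "spectrum (distance_matrix G (vertex_enum G)) = {\<mu>. distance_eigenvalue G \<mu>}"
    and "finite (spectrum (distance_matrix G (vertex_enum G)))"
proof -
  show "spectrum (distance_matrix G (vertex_enum G)) = {\<mu>. distance_eigenvalue G \<mu>}"
    unfolding spectrum_def eigenvalue_distance_matrix_iff[OF vertex_enum(1)[OF assms]]
      distance_eigenvalue_def vertex_enum(2)[OF assms] ..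
  have "distance_matrix G (vertex_enum G) \<in>
      carrier_mat (length (vertex_enum G)) (length (vertex_enum G))"
    by (simp add: distance_matrix_def)
  then show "finite (spectrum (distance_matrix G (vertex_enum G)))"
    using card_finite_spectrum(1) by blast
qed

lemma distance_spectral_radius_ge:
  assumes "finite (verts G)" and "distance_eigenvalue G \<mu>"
  shows "\<mu> \<le> \<rho>\<^sub>D G"
  unfolding distance_spectral_radius_def
  using spectrum_distance_matrix[OF assms(1)] assms(2) by (intro Max_ge) auto

lemma distance_eigenvalue_above_mean:
  assumes "finite (verts G)" and "verts G \<noteq> {}"
  obtains \<mu> where "distance_eigenvalue G \<mu>"
    and "(\<Sum>u\<in>verts G. \<Sum>v\<in>verts G. real (distance G u v)) \<le> \<mu> * real (order_graph G)"
proof -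
  have sym: "real (distance G u v) = real (distance G v u)" for u v
    by (subst distance_sym) (rule refl)
  show thesis
  proof (rule symmetric_form_maximum_eigenvalue[where D = "\<lambda>u v. real (distance G u v)", OF assms sym])
    fix \<mu> f
    assume "\<exists>v\<in>verts G. f v \<noteq> 0"
      and "\<forall>u\<in>verts G. (\<Sum>v\<in>verts G. real (distance G u v) * f v) = \<mu> * f u"
      and max: "\<And>g. (\<Sum>u\<in>verts G. \<Sum>v\<in>verts G. real (distance G u v) * g u * g v)
        \<le> \<mu> * (\<Sum>v\<in>verts G. (g v)\<^sup>2)"
    then have "distance_eigenvalue G \<mu>" unfolding distance_eigenvalue_def by blast
    \<comment> \<open>The constant function 1 turns the form into the sum of all distances and the
      squared norm into the order.\<close>
    then show thesis using that max[of "\<lambda>_. 1"] by (simp add: order_graph_def)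
  qed
qed

text \<open>\<open>Max\<close> has its meaning only for a finite nonempty set. The maximum of the
  quadratic form supplies a real eigenvalue, so the spectrum is nonempty.\<close>

lemma distance_eigenvalue_spectral_radius:
  assumes "finite (verts G)" and "verts G \<noteq> {}"
  shows "distance_eigenvalue G (\<rho>\<^sub>D G)"
proof -
  obtain \<mu> where "distance_eigenvalue G \<mu>" using distance_eigenvalue_above_mean[OF assms] by metis
  then have "spectrum (distance_matrix G (vertex_enum G)) \<noteq> {}"
    using spectrum_distance_matrix(1)[OF assms(1)] by auto
  then have "\<rho>\<^sub>D G \<in> spectrum (distance_matrix G (vertex_enum G))"
    unfolding distance_spectral_radius_def
    using spectrum_distance_matrix(2)[OF assms(1)] by (intro Max_in)
  then show ?thesis using spectrum_distance_matrix(1)[OF assms(1)] by simp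
qed

lemma distance_spectral_radius_ge_mean:
  assumes "finite (verts G)" and "verts G \<noteq> {}"
  shows "(\<Sum>u\<in>verts G. \<Sum>v\<in>verts G. real (distance G u v)) \<le> \<rho>\<^sub>D G * real (order_graph G)"
proof -
  obtain \<mu> where \<mu>: "distance_eigenvalue G \<mu>"
    "(\<Sum>u\<in>verts G. \<Sum>v\<in>verts G. real (distance G u v)) \<le> \<mu> * real (order_graph G)"
    using distance_eigenvalue_above_mean[OF assms] .
  have "\<mu> * real (order_graph G) \<le> \<rho>\<^sub>D G * real (order_graph G)"
    using distance_spectral_radius_ge[OF assms(1) \<mu>(1)] by (intro mult_right_mono) auto
  then show ?thesis using \<mu>(2) by simp
qed

lemma distance_spectral_radius_le:
  assumes "finite (verts G)" and "verts G \<noteq> {}" and "\<And>v. v \<in> verts G \<Longrightarrow> x v > 0"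
    and "\<And>u. u \<in> verts G \<Longrightarrow> (\<Sum>v\<in>verts G. real (distance G u v) * x v) \<le> c * x u"
  shows "\<rho>\<^sub>D G \<le> c"
proof -
  obtain f where "\<exists>v\<in>verts G. f v \<noteq> 0"
    "\<forall>u\<in>verts G. (\<Sum>v\<in>verts G. real (distance G u v) * f v) = \<rho>\<^sub>D G * f u"
    using distance_eigenvalue_spectral_radius[OF assms(1,2)] by (auto simp: distance_eigenvalue_def)
  then show ?thesis
    using nonneg_eigenvalue_le[of "verts G" "\<lambda>u v. real (distance G u v)" x c f] assms by simp
qed

section \<open>Edges of graphs with small distance spectral radius\<close>

lemma finite_edges: "simple_graph G \<Longrightarrow> finite (edges G)"
  unfolding simple_graph_def by (rule finite_subset[of _ "Pow (verts G)"]) auto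

lemma card_neighbours:
  assumes "simple_graph G"
  shows "card {v \<in> verts G. {u, v} \<in> edges G} = degree_in G u"
proof -
  have "bij_betw (\<lambda>v. {u, v}) {v \<in> verts G. {u, v} \<in> edges G} {e \<in> edges G. u \<in> e}"
  proof (rule bij_betwI')
    fix e assume e: "e \<in> {e \<in> edges G. u \<in> e}"
    then have "e \<subseteq> verts G" "card e = 2" "u \<in> e" using assms by (auto simp: simple_graph_def)
    then obtain v where "e = {u, v}" "v \<in> verts G" by (auto simp: card_2_iff)
    then show "\<exists>v\<in>{v \<in> verts G. {u, v} \<in> edges G}. e = {u, v}" using e by auto
  qed (auto simp: doubleton_eq_iff)
  then show ?thesis unfolding degree_in_def by (rule bij_betw_same_card)
qed

lemma handshake:
  assumes "simple_graph G"
  shows "(\<Sum>v\<in>verts G. degree_in G v) = 2 * card (edges G)"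
proof -
  have fin: "finite (verts G)" "finite (edges G)"
    using assms finite_edges by (auto simp: simple_graph_def)
  have "(\<Sum>v\<in>verts G. card {e \<in> edges G. v \<in> e}) = (\<Sum>e\<in>edges G. 2)"
  proof (rule sum_multicount_gen[OF fin], rule ballI)
    fix e assume "e \<in> edges G"
    then have "{v \<in> verts G. v \<in> e} = e" "card e = 2" using assms by (auto simp: simple_graph_def)
    then show "card {v \<in> verts G. v \<in> e} = 2" by simp
  qed
  then show ?thesis by (simp add: degree_in_def)
qed

text \<open>Each vertex other than \<open>u\<close> is at distance at least 2, or is a neighbour at
  distance at least 1; the degree makes up the missing 1 per neighbour.\<close>

lemma transmission_ge:
  assumes "simple_graph G" "connected_graph G" "u \<in> verts G"
  shows "2 * (real (order_graph G) - 1) \<le> (\<Sum>v\<in>verts G. real (distance G u v)) + real (degree_in G u)"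
proof -
  have fin: "finite (verts G)" using assms(1) by (simp add: simple_graph_def)
  have deg: "real (degree_in G u) = (\<Sum>v\<in>verts G. if {u, v} \<in> edges G then 1 else 0)"
    using fin by (simp add: card_neighbours[OF assms(1), symmetric] sum.If_cases Int_def)
  have "2 * (real (order_graph G) - 1) = (\<Sum>v\<in>verts G. if v = u then 0 else 2)"
    using fin assms(3) sum.remove[OF fin assms(3), of "\<lambda>v. if v = u then 0 else 2 :: real"]
      card_Suc_Diff1[OF fin assms(3)]
    by (simp add: order_graph_def)
  also have "\<dots> \<le> (\<Sum>v\<in>verts G. real (distance G u v) + (if {u, v} \<in> edges G then 1 else 0))"
  proof (rule sum_mono)
    fix v assume v: "v \<in> verts G"
    show "(if v = u then 0 else 2) \<le> real (distance G u v) + (if {u, v} \<in> edges G then 1 else 0)"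
      using distance_ge[OF assms(2,3) v] by (auto split: if_splits)
  qed
  finally show ?thesis by (simp add: sum.distrib deg)
qed

text \<open>Summation over \<open>u\<close> turns the degrees into twice the number of edges and
  bounds the distances through the mean. A small radius thus forces many edges.\<close>

lemma distance_spectral_radius_edges:
  assumes "simple_graph G" "connected_graph G" "order_graph G = n"
  shows "2 * real n * (real n - 1) \<le> \<rho>\<^sub>D G * real n + 2 * real (card (edges G))"
proof -
  have fin: "finite (verts G)" and ne: "verts G \<noteq> {}"
    using assms by (auto simp: simple_graph_def connected_graph_def)
  have "(\<Sum>u\<in>verts G. 2 * (real n - 1)) \<le>
      (\<Sum>u\<in>verts G. (\<Sum>v\<in>verts G. real (distance G u v)) + real (degree_in G u))"
    using transmission_ge[OF assms(1,2)] assms(3) by (intro sum_mono) auto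
  also have "\<dots> = (\<Sum>u\<in>verts G. \<Sum>v\<in>verts G. real (distance G u v)) + 2 * real (card (edges G))"
    using arg_cong[OF handshake[OF assms(1)], of real] by (simp add: sum.distrib)
  also have "\<dots> \<le> \<rho>\<^sub>D G * real n + 2 * real (card (edges G))"
    using distance_spectral_radius_ge_mean[OF fin ne] assms(3) by simp
  finally show ?thesis using assms(3) by (simp add: order_graph_def mult_ac)
qed

section \<open>Distances in the extremal graph and its test vector\<close>

lemma distance_adjacent:
  assumes "{u, v} \<in> edges G" "u \<in> verts G" "v \<in> verts G" "u \<noteq> v"
  shows "distance G u v \<le> 1"
  using distance_le[of G u "[u, v]" v] assms
  by (simp add: path_between_def is_path_def path_length_def)

lemma distance_common_neighbour:
  assumes "{u, w} \<in> edges G" "{w, v} \<in> edges G" "u \<in> verts G" "v \<in> verts G" "w \<in> verts G"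
    "u \<noteq> v" "u \<noteq> w" "w \<noteq> v"
  shows "distance G u v \<le> 2"
  using distance_le[of G u "[u, w, v]" v] assms
  by (simp add: path_between_def is_path_def path_length_def)

lemma edges_complete_graphI: "i < m \<Longrightarrow> j < m \<Longrightarrow> i \<noteq> j \<Longrightarrow> {i, j} \<in> edges (complete_graph m)"
  by (auto simp: complete_graph_def)

lemma edges_graph_unionI:
  "e \<in> edges G \<Longrightarrow> Inl ` e \<in> edges (graph_union G H)"
  "e' \<in> edges H \<Longrightarrow> Inr ` e' \<in> edges (graph_union G H)"
  by (simp_all add: graph_union_def)

lemma edges_graph_joinI:
  "e \<in> edges G \<Longrightarrow> Inl ` e \<in> edges (graph_join G H)"
  "e' \<in> edges H \<Longrightarrow> Inr ` e' \<in> edges (graph_join G H)"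
  "u \<in> verts G \<Longrightarrow> v \<in> verts H \<Longrightarrow> {Inl u, Inr v} \<in> edges (graph_join G H)"
  by (auto simp: graph_join_def edges_graph_unionI)

text \<open>The test vector is constant on the clique; the value \<open>2 - 1 / n\<close> at the remaining vertex
  makes the bound strictly smaller than \<open>n + 2\<close>.\<close>

lemma extremal_distance_spectral_radius:
  assumes k: "k \<ge> 2" and n: "n \<ge> k + 2"
  shows "\<rho>\<^sub>D (graph_join (complete_graph (k - 1)) (graph_union (complete_graph (n - k)) (complete_graph 1)))
    \<le> real n + 2 - 2 / real n"
proof -
  define H where "H = graph_join (complete_graph (k - 1))
    (graph_union (complete_graph (n - k)) (complete_graph 1))"
  have V: "verts H = {..<k - 1} <+> ({..<n - k} <+> {..<1})"
    by (simp add: H_def graph_join_def graph_union_def complete_graph_def)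
  have adj: "{Inl i, Inl j} \<in> edges H" if "i < k - 1" "j < k - 1" "i \<noteq> j" for i j
    unfolding H_def using edges_graph_joinI(1)[OF edges_complete_graphI[OF that]] by simp
  have adj': "{Inr (Inl i), Inr (Inl j)} \<in> edges H" if "i < n - k" "j < n - k" "i \<noteq> j" for i j
    unfolding H_def using edges_graph_joinI(2)[OF edges_graph_unionI(1)[OF edges_complete_graphI[OF that]]] by simp
  have join: "{Inl i, Inr b} \<in> edges H" if "i < k - 1" "b \<in> {..<n - k} <+> {..<1}" for i b
    unfolding H_def using that by (intro edges_graph_joinI(3)) (simp_all add: graph_union_def complete_graph_def)
  have join': "{Inr b, Inl i} \<in> edges H" if "i < k - 1" "b \<in> {..<n - k} <+> {..<1}" for i b
    using join[OF that] by (simp add: insert_commute)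
  have inV: "Inl i \<in> verts H" if "i < k - 1" for i using that by (auto simp: V)
  have inV': "Inr b \<in> verts H" if "b \<in> {..<n - k} <+> {..<1}" for b using that by (auto simp: V)
  have d_ll: "distance H (Inl i) (Inl j) \<le> (if j = i then 0 else 1)" if "i < k - 1" "j < k - 1" for i j
    using distance_self[OF inV[OF that(1)]] distance_adjacent[OF adj inV inV] that by auto
  have d_lr: "distance H (Inl i) (Inr b) \<le> 1" if "i < k - 1" "b \<in> {..<n - k} <+> {..<1}" for i b
    using distance_adjacent[OF join inV inV'] that by auto
  have d_rl: "distance H (Inr b) (Inl i) \<le> 1" if "i < k - 1" "b \<in> {..<n - k} <+> {..<1}" for i b
    using distance_adjacent[OF join' inV' inV] that by auto
  have d_rr: "distance H (Inr (Inl i)) (Inr (Inl j)) \<le> (if j = i then 0 else 1)"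
    if "i < n - k" "j < n - k" for i j
    using distance_self[OF inV'[of "Inl i"]] distance_adjacent[OF adj' inV' inV'] that by auto
  \<comment> \<open>Since \<open>k >= 2\<close>, the vertex \<open>Inl 0\<close> exists; it is a
    common neighbour of all vertices \<open>Inr b\<close>.\<close>
  have zero: "0 < k - 1" using k by simp
  have d_rr2: "distance H (Inr b) (Inr c) \<le> 2"
    if "b \<in> {..<n - k} <+> {..<1}" "c \<in> {..<n - k} <+> {..<1}" "b \<noteq> c" for b c
    using distance_common_neighbour[OF join'[OF zero that(1)] join[OF zero that(2)]
        inV'[OF that(1)] inV'[OF that(2)] inV[OF zero]] that(3) by simp
  have d_top: "distance H (Inr (Inr 0)) (Inr (Inr 0)) = 0"
    using distance_self[OF inV'[of "Inr 0"]] by auto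
  define c where "c = 2 - 1 / real n"
  have npos: "real n \<ge> 4" using k n by linarith
  have c: "c \<ge> 1" "c \<le> 2" using npos by (auto simp: c_def field_simps)
  define x :: "nat + nat + nat \<Rightarrow> real" where
    "x v = (case v of Inr (Inr _) \<Rightarrow> c | _ \<Rightarrow> 1)" for v
  have x: "x (Inl i) = 1" "x (Inr (Inl j)) = 1" "x (Inr (Inr l)) = c" for i j l
    by (simp_all add: x_def)
  have sum_V: "(\<Sum>v\<in>verts H. real (distance H u v) * x v) =
      (\<Sum>j<k - 1. real (distance H u (Inl j))) + (\<Sum>j<n - k. real (distance H u (Inr (Inl j))))
      + real (distance H u (Inr (Inr 0))) * c" for u
    unfolding V by (simp add: sum.Plus x)
  have sum_const: "(\<Sum>j<m. real (g j)) \<le> real m * b" if "\<And>j. j < m \<Longrightarrow> real (g j) \<le> b"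
    for m :: nat and g :: "nat \<Rightarrow> nat" and b :: real
    using sum_bounded_above[of "{..<m}" "\<lambda>j. real (g j)" b] that by simp
  have sum_off: "(\<Sum>j<m. real (g j)) \<le> real m - 1"
    if "i < m" "\<And>j. j < m \<Longrightarrow> g j \<le> (if j = i then 0 else 1)" for m i :: nat and g :: "nat \<Rightarrow> nat"
  proof -
    have "(\<Sum>j<m. real (g j)) = real (g i) + (\<Sum>j\<in>{..<m} - {i}. real (g j))"
      using that(1) by (intro sum.remove) auto
    moreover have "(\<Sum>j\<in>{..<m} - {i}. real (g j)) \<le> real (card ({..<m} - {i})) * 1"
    proof (rule sum_bounded_above)
      show "real (g j) \<le> 1" if "j \<in> {..<m} - {i}" for j
        using \<open>\<And>j. j < m \<Longrightarrow> g j \<le> (if j = i then 0 else 1)\<close>[of j] that by simp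
    qed
    moreover have "g i = 0" using that(2)[OF that(1)] by simp
    ultimately show ?thesis using that(1) by (simp add: of_nat_diff)
  qed
  have kk: "real (k - 1) = real k - 1" "real (n - k) = real n - real k" using k n by auto
  show ?thesis unfolding H_def[symmetric]
  proof (rule distance_spectral_radius_le[where x = x])
    show "finite (verts H)" by (simp add: V)
    show "verts H \<noteq> {}" using inV[OF zero] by blast
    show "x v > 0" for v using c by (auto simp: x_def split: sum.split)
  next
    fix u assume "u \<in> verts H"
    then consider i where "u = Inl i" "i < k - 1" | j where "u = Inr (Inl j)" "j < n - k"
      | "u = Inr (Inr 0)" by (auto simp: V)
    then show "(\<Sum>v\<in>verts H. real (distance H u v) * x v) \<le> (real n + 2 - 2 / real n) * x u"
    proof cases
      case (1 i)
      have "(\<Sum>j<k - 1. real (distance H u (Inl j))) \<le> real (k - 1) - 1"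
        using d_ll 1 by (intro sum_off[of i]) auto
      moreover have "(\<Sum>j<n - k. real (distance H u (Inr (Inl j)))) \<le> real (n - k) * 1"
        using d_lr 1 by (intro sum_const) auto
      moreover have "real (distance H u (Inr (Inr 0))) * c \<le> 1 * c"
        using d_lr[of i "Inr 0"] 1 c by (intro mult_right_mono) auto
      ultimately have "(\<Sum>v\<in>verts H. real (distance H u v) * x v) \<le> real n - 2 + c"
        unfolding sum_V kk by simp
      also have "\<dots> \<le> real n + 2 - 2 / real n" using c npos by (simp add: c_def field_simps)
      finally show ?thesis using 1 by (simp add: x)
    next
      case (2 j)
      have "(\<Sum>j<k - 1. real (distance H u (Inl j))) \<le> real (k - 1) * 1"
        using d_rl[of _ "Inl j"] 2 by (intro sum_const) auto
      moreover have "(\<Sum>j<n - k. real (distance H u (Inr (Inl j)))) \<le> real (n - k) - 1"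
        using d_rr 2 by (intro sum_off[of j]) auto
      moreover have "real (distance H u (Inr (Inr 0))) * c \<le> 2 * c"
        using d_rr2[of "Inl j" "Inr 0"] 2 c by (intro mult_right_mono) auto
      \<comment> \<open>This row is tight: \<open>n - 2 + 2 * c\<close> equals
        \<open>n + 2 - 2 / n\<close>, the bound being proved.\<close>
      ultimately have "(\<Sum>v\<in>verts H. real (distance H u v) * x v) \<le> real n - 2 + 2 * c"
        unfolding sum_V kk by simp
      then show ?thesis using 2 by (simp add: x c_def)
    next
      case 3
      have "(\<Sum>j<k - 1. real (distance H u (Inl j))) \<le> real (k - 1) * 1"
        using d_rl[of _ "Inr 0"] 3 by (intro sum_const) auto
      moreover have "(\<Sum>j<n - k. real (distance H u (Inr (Inl j)))) \<le> real (n - k) * 2"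
        using d_rr2[of "Inr 0" "Inl _"] 3 by (intro sum_const) auto
      ultimately have "(\<Sum>v\<in>verts H. real (distance H u v) * x v) \<le> 2 * real n - real k - 1"
        unfolding sum_V kk using 3 d_top by simp
      \<comment> \<open>The product exceeds \<open>2 * n + 1\<close>, because \<open>6 / n\<close>
        is at most 2.\<close>
      also have "\<dots> \<le> (real n + 2 - 2 / real n) * c"
      proof -
        have "(real n + 2 - 2 / real n) * c = 2 * real n + 3 - 6 / real n + 2 / (real n)\<^sup>2"
          using npos by (simp add: c_def field_simps power2_eq_square)
        moreover have "6 / real n \<le> 2" using npos by (simp add: field_simps)
        ultimately show ?thesis by (simp add: add_increasing2)
      qed
      finally show ?thesis using 3 by (simp add: x)
    qed
  qed
qed

section \<open>Edges crossing a partition\<close>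

lemma sum_squares_le_square_sum:
  fixes t :: "'a \<Rightarrow> int"
  assumes "finite A" and "\<And>x. x \<in> A \<Longrightarrow> t x \<ge> 0"
  shows "(\<Sum>x\<in>A. (t x)\<^sup>2) \<le> (\<Sum>x\<in>A. t x)\<^sup>2"
proof -
  have "(\<Sum>x\<in>A. (t x)\<^sup>2) \<le> (\<Sum>x\<in>A. t x * (\<Sum>y\<in>A. t y))"
  proof (rule sum_mono)
    fix x assume x: "x \<in> A"
    then have "t x \<le> (\<Sum>y\<in>A. t y)" using assms by (intro member_le_sum) auto
    then show "(t x)\<^sup>2 \<le> t x * (\<Sum>y\<in>A. t y)"
      using assms(2)[OF x] by (simp add: power2_eq_square mult_left_mono)
  qed
  then show ?thesis by (simp add: power2_eq_square sum_distrib_right)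
qed

text \<open>By convexity the worst case has one term equal to 1 and all the rest in a single other
  term. With \<open>r\<close> the sum without \<open>t x\<close>, this is
  \<open>(t x - 1) * (r - 1) >= 0\<close>.\<close>

lemma sum_squares_le_two_positive:
  fixes t :: "'a \<Rightarrow> int"
  assumes "finite A" and nonneg: "\<And>x. x \<in> A \<Longrightarrow> t x \<ge> 0"
    and xy: "x \<in> A" "y \<in> A" "x \<noteq> y" "t x \<ge> 1" "t y \<ge> 1"
  shows "(\<Sum>x\<in>A. (t x)\<^sup>2) \<le> ((\<Sum>x\<in>A. t x) - 1)\<^sup>2 + 1"
proof -
  let ?r = "\<Sum>z\<in>A - {x}. t z"
  have "t y \<le> ?r" using assms by (intro member_le_sum) auto
  then have r: "?r \<ge> 1" using xy by simp
  have s: "(\<Sum>x\<in>A. t x) = t x + ?r" using assms(1) xy(1) by (rule sum.remove)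
  have "(\<Sum>x\<in>A. (t x)\<^sup>2) = (t x)\<^sup>2 + (\<Sum>z\<in>A - {x}. (t z)\<^sup>2)" using assms(1) xy(1) by (rule sum.remove)
  also have "\<dots> \<le> (t x)\<^sup>2 + ?r\<^sup>2" using assms by (auto intro!: sum_squares_le_square_sum)
  also have "\<dots> \<le> (t x + ?r - 1)\<^sup>2 + 1"
  proof -
    have "0 \<le> (t x - 1) * (?r - 1)" using xy r by (intro mult_nonneg_nonneg) auto
    then show ?thesis by (simp add: power2_eq_square algebra_simps)
  qed
  finally show ?thesis by (simp only: s)
qed

text \<open>A class \<open>X\<close> contains at most \<open>card X choose 2\<close> edges; doubling
  avoids a division.\<close>

lemma card_edges_inside_partition:
  assumes G: "simple_graph G" and P: "partition_on (verts G) P"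
  shows "2 * card {e \<in> edges G. \<exists>X\<in>P. e \<subseteq> X} \<le> (\<Sum>X\<in>P. card X * (card X - 1))"
proof -
  have fin: "finite (verts G)" using G by (simp add: simple_graph_def)
  have finP: "finite P" using P fin by (rule finite_elements[rotated])
  have finX: "finite X" if "X \<in> P" for X
    using that P fin by (metis Union_upper finite_subset partition_onD1)
  have "{e \<in> edges G. \<exists>X\<in>P. e \<subseteq> X} \<subseteq> (\<Union>X\<in>P. {e. e \<subseteq> X \<and> card e = 2})"
    using G by (auto simp: simple_graph_def)
  then have "card {e \<in> edges G. \<exists>X\<in>P. e \<subseteq> X} \<le> card (\<Union>X\<in>P. {e. e \<subseteq> X \<and> card e = 2})"
    using finP finX by (intro card_mono) auto
  also have "\<dots> \<le> (\<Sum>X\<in>P. card {e. e \<subseteq> X \<and> card e = 2})" by (rule card_UN_le[OF finP])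
  also have "\<dots> = (\<Sum>X\<in>P. card X choose 2)" using finX by (intro sum.cong refl) (simp add: n_subsets)
  finally have "2 * card {e \<in> edges G. \<exists>X\<in>P. e \<subseteq> X} \<le> (\<Sum>X\<in>P. 2 * (card X choose 2))"
    by (simp flip: sum_distrib_left)
  also have "\<dots> = (\<Sum>X\<in>P. card X * (card X - 1))"
  proof (rule sum.cong[OF refl])
    fix X
    have "even (card X * (card X - 1))" by (cases "card X") auto
    then show "2 * (card X choose 2) = card X * (card X - 1)"
      unfolding choose_two by (rule dvd_mult_div_cancel)
  qed
  finally show ?thesis .
qed

text \<open>An edge at \<open>v\<close> has a second end, which lies in another class. This lets
  degree bounds control partitions with singleton classes.\<close>

lemma singleton_class_edges_cross:
  assumes G: "simple_graph G" and P: "partition_on (verts G) P" and v: "{v} \<in> P"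
  shows "{e \<in> edges G. v \<in> e} \<subseteq> {e \<in> edges G. \<forall>X\<in>P. \<not> e \<subseteq> X}"
proof (intro subsetI CollectI conjI ballI notI)
  fix e X assume e: "e \<in> {e \<in> edges G. v \<in> e}" and X: "X \<in> P" "e \<subseteq> X"
  then have "v \<in> X" by blast
  then have "X = {v}" using disjointD[OF partition_onD2[OF P] X(1) v] by blast
  then have "card e \<le> 1" using X(2) card_mono[of "{v}" e] by simp
  then show False using e G by (simp add: simple_graph_def)
qed auto

text \<open>With \<open>p\<close> classes, counting edges settles \<open>p \<ge> 4\<close>, and also \<open>p \<le> 3\<close> if two classes are
  not singletons; otherwise the degrees of the singletons suffice.\<close>

lemma dense_graph_partition_condition:
  assumes G: "simple_graph G" "order_graph G = n" and n: "n \<ge> 2 * k + 8"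
    and deg: "\<And>v. v \<in> verts G \<Longrightarrow> degree_in G v \<ge> k + 2"
    and dense: "int n * (int n - 4) < 2 * int (card (edges G))"
    and P: "partition_on (verts G) P"
  shows "(k + 1) * (card P - 1) \<le> card {e \<in> edges G. \<forall>X\<in>P. \<not> e \<subseteq> X}"
proof -
  let ?C = "{e \<in> edges G. \<forall>X\<in>P. \<not> e \<subseteq> X}" and ?I = "{e \<in> edges G. \<exists>X\<in>P. e \<subseteq> X}"
  have fin: "finite (verts G)" using G by (simp add: simple_graph_def)
  have finE: "finite (edges G)" using finite_edges[OF G(1)] .
  have finP: "finite P" using P fin by (rule finite_elements[rotated])
  have ne: "verts G \<noteq> {}" using G(2) n by (auto simp: order_graph_def)
  have finX: "finite X" if "X \<in> P" for X
    using that P fin by (metis Union_upper finite_subset partition_onD1)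
  have card1: "card X \<ge> 1" if "X \<in> P" for X
  proof -
    have "X \<noteq> {}" using that partition_onD3[OF P] by blast
    then show ?thesis using finX[OF that] by (simp add: Suc_le_eq card_gt_0_iff)
  qed
  have "edges G = ?C \<union> ?I" "?C \<inter> ?I = {}" by auto
  then have split: "card (edges G) = card ?C + card ?I"
    using finE by (metis (no_types, lifting) card_Un_disjoint finite_Un)
  \<comment> \<open>The excess \<open>t X\<close> of a class over a singleton sums to
    \<open>u = n - 1 - q\<close>, where \<open>q\<close> is the number of classes minus one. Twice
    the number of pairs inside \<open>X\<close> becomes \<open>(t X)\<^sup>2 + t X\<close>.\<close>
  define t where "t X = int (card X) - 1" for X :: "'a set"
  have t0: "t X \<ge> 0" if "X \<in> P" for X using card1[OF that] by (simp add: t_def)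
  define u where "u = (\<Sum>X\<in>P. t X)"
  define q where "q = card P - 1"
  have "card P > 0" using finP P ne by (metis card_gt_0_iff partition_onD1 Union_empty)
  then have cardP: "card P = q + 1" by (simp add: q_def)
  have "n = (\<Sum>X\<in>P. card X)"
    using product_partition[OF P finX] G(2) by (simp add: order_graph_def)
  then have u: "u = int n - 1 - int q"
    by (simp add: u_def t_def sum_subtractf cardP)
  have u0: "u \<ge> 0" unfolding u_def using t0 by (intro sum_nonneg)
  have "2 * int (card ?I) \<le> (\<Sum>X\<in>P. int (card X * (card X - 1)))"
    using card_edges_inside_partition[OF G(1) P] by (simp flip: of_nat_sum of_nat_mult)
  also have "\<dots> = (\<Sum>X\<in>P. (t X)\<^sup>2 + t X)"
    using card1 by (intro sum.cong refl) (simp add: t_def of_nat_diff power2_eq_square algebra_simps)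
  finally have I: "2 * int (card ?I) \<le> (\<Sum>X\<in>P. (t X)\<^sup>2) + u" by (simp add: sum.distrib u_def)
  have C: "int n * (int n - 4) - (\<Sum>X\<in>P. (t X)\<^sup>2) - u < 2 * int (card ?C)"
    using dense split I by simp
  have finC: "finite ?C" using finE by simp
  have "(k + 1) * q \<le> card ?C"
  proof (cases "q \<ge> 3")
    case True
    have "(\<Sum>X\<in>P. (t X)\<^sup>2) \<le> u\<^sup>2" unfolding u_def using finP t0 by (rule sum_squares_le_square_sum)
    with C have "int n * (int n - 4) - u\<^sup>2 - u < 2 * int (card ?C)" by linarith
    \<comment> \<open>The term \<open>q * (n - 6)\<close> is split off because
      \<open>n >= 2 * k + 8\<close> makes it at least twice the required \<open>(k + 1) * q\<close>;
      the remainder is positive once \<open>q >= 3\<close>.\<close>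
    moreover have "int n * (int n - 4) - u\<^sup>2 - u =
        int q * (int n - 6) + (int q - 3) * (int n - int q + 2) + 6"
      by (simp add: u power2_eq_square algebra_simps)
    moreover have "(int q - 3) * (int n - int q + 2) \<ge> 0" using True u0 u by simp
    moreover have "int q * (int n - 6) \<ge> int q * (2 * int (k + 1))"
      using n by (intro mult_left_mono) auto
    ultimately have "2 * int ((k + 1) * q) < 2 * int (card ?C)" by (simp add: algebra_simps)
    then show ?thesis by linarith
  next
    case False
    then consider "q = 0" | "q = 1" | "q = 2" by linarith
    note q_cases = this
    show ?thesis
    proof (cases "\<exists>X\<in>P. \<exists>Y\<in>P. X \<noteq> Y \<and> card X \<ge> 2 \<and> card Y \<ge> 2")
      case True
      then obtain X Y where XY: "X \<in> P" "Y \<in> P" "X \<noteq> Y" "card X \<ge> 2" "card Y \<ge> 2"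
        by blast
      then have "t X \<ge> 1" "t Y \<ge> 1" by (simp_all add: t_def)
      with XY(1-3) have "(\<Sum>X\<in>P. (t X)\<^sup>2) \<le> (u - 1)\<^sup>2 + 1"
        unfolding u_def using finP t0 by (intro sum_squares_le_two_positive)
      with C have *: "int n * (int n - 4) - (u - 1)\<^sup>2 - 1 - u < 2 * int (card ?C)" by linarith
      from q_cases show ?thesis
      proof cases
        case 2
        \<comment> \<open>With \<open>n >= 2 * k + 8\<close> this gives
          \<open>2 * k < 2 * card ?C\<close>, hence just the required \<open>k + 1\<close>
          edges.\<close>
        then have "int n - 8 < 2 * int (card ?C)"
          using * by (simp add: u power2_eq_square algebra_simps)
        then show ?thesis using 2 n by simp
      next
        case 3
        then have "3 * int n - 14 < 2 * int (card ?C)"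
          using * by (simp add: u power2_eq_square algebra_simps)
        then show ?thesis using 3 n by simp
      qed simp
    next
      case False
      \<comment> \<open>At most one class is not a singleton; \<open>X0\<close> is that class, or an
        arbitrary one if all are singletons.\<close>
      have "\<exists>X0\<in>P. \<forall>Y\<in>P - {X0}. card Y = 1"
      proof (cases "\<exists>X\<in>P. card X \<ge> 2")
        case True
        then obtain X where X: "X \<in> P" "card X \<ge> 2" by blast
        have "card Y = 1" if "Y \<in> P - {X}" for Y
        proof -
          have "\<not> card Y \<ge> 2" using False X that by blast
          then show ?thesis using card1[of Y] that by simp
        qed
        then show ?thesis using X by blast
      next
        case no: False
        have "card Y = 1" if "Y \<in> P" for Y
        proof -
          have "\<not> card Y \<ge> 2" using no that by blast
          then show ?thesis using card1[of Y] that by simp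
        qed
        moreover obtain X where "X \<in> P" using \<open>card P > 0\<close> by (metis card_gt_0_iff ex_in_conv)
        ultimately show ?thesis by blast
      qed
      then obtain X0 where X0: "X0 \<in> P" "\<And>Y. Y \<in> P - {X0} \<Longrightarrow> card Y = 1" by blast
      have cardS: "card (P - {X0}) = q" using X0(1) finP cardP by simp
      have single: "v \<in> verts G \<and> {e \<in> edges G. v \<in> e} \<subseteq> ?C" if "{v} \<in> P" for v
        using singleton_class_edges_cross[OF G(1) P that] that partition_onD1[OF P] by blast
      from q_cases show ?thesis
      proof cases
        case 2
        then obtain Y where "P - {X0} = {Y}" using cardS by (auto simp: card_1_singleton_iff)
        then have "Y \<in> P" "card Y = 1" using X0(2) by auto
        then obtain v where v: "{v} \<in> P" by (auto simp: card_1_singleton_iff)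
        then have "k + 2 \<le> card ?C"
          using deg[of v] single[OF v] card_mono[OF finC, of "{e \<in> edges G. v \<in> e}"]
          by (auto simp: degree_in_def)
        then show ?thesis using 2 by simp
      next
        case 3
        then obtain Y Z where YZ: "P - {X0} = {Y, Z}" "Y \<noteq> Z" using cardS by (auto simp: card_2_iff)
        then have "Y \<in> P" "card Y = 1" "Z \<in> P" "card Z = 1" using X0(2) by auto
        then obtain v w where v: "{v} \<in> P" and w: "{w} \<in> P" and vw: "v \<noteq> w"
          using YZ(2) by (auto simp: card_1_singleton_iff)
        let ?A = "{e \<in> edges G. v \<in> e}" and ?B = "{e \<in> edges G. w \<in> e}"
        \<comment> \<open>Two vertices share at most one edge, so at least
          \<open>2 * (k + 2) - 1\<close> edges cross, more than \<open>2 * (k + 1)\<close>.\<close>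
        have "e = {v, w}" if "e \<in> ?A \<inter> ?B" for e
        proof -
          have "card e = 2" using that G(1) by (auto simp: simple_graph_def)
          then show ?thesis using that vw by (auto simp: card_2_iff)
        qed
        then have "?A \<inter> ?B \<subseteq> {{v, w}}" by blast
        then have "card (?A \<inter> ?B) \<le> 1" using card_mono[of "{{v, w}}" "?A \<inter> ?B"] by simp
        moreover have "card ?A + card ?B = card (?A \<union> ?B) + card (?A \<inter> ?B)"
          using finE by (intro card_Un_Int) auto
        moreover have "card (?A \<union> ?B) \<le> card ?C"
          using single[OF v] single[OF w] by (intro card_mono[OF finC]) auto
        moreover have "card ?A \<ge> k + 2" "card ?B \<ge> k + 2"
          using deg[of v] deg[of w] single[OF v] single[OF w] by (auto simp: degree_in_def)
        ultimately show ?thesis using 3 by simp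
      qed simp
    qed
  qed
  then show ?thesis by (simp add: q_def)
qed

theorem theorem1p5:
  fixes G :: "'a ugraph" and k n :: nat
  assumes "k \<ge> 2"
    and "simple_graph G" and "connected_graph G"
    and "order_graph G = n" and "n \<ge> 2 * k + 8"
    and "min_degree G \<ge> k + 2"
    and "\<rho>\<^sub>D G \<le> \<rho>\<^sub>D (graph_join (complete_graph (k - 1))
                          (graph_union (complete_graph (n - k)) (complete_graph 1)))"
  shows "property_P k (min_degree G) G"
proof -
  have fin: "finite (verts G)" and ne: "verts G \<noteq> {}"
    using assms(2,3) by (auto simp: simple_graph_def connected_graph_def)
  have n0: "real n > 0" using assms(5) by simp
  have "\<rho>\<^sub>D G \<le> real n + 2 - 2 / real n"
    using assms(7) extremal_distance_spectral_radius[OF assms(1), of n] assms(5) by simp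
  \<comment> \<open>After multiplication by \<open>n\<close> the term \<open>2 / n\<close> becomes a
    surplus of 2, which makes the edge bound strict.\<close>
  then have "\<rho>\<^sub>D G * real n \<le> (real n + 2 - 2 / real n) * real n"
    using n0 by (intro mult_right_mono) auto
  also have "\<dots> = real n * (real n + 2) - 2" using n0 by (simp add: field_simps)
  finally have "real n * (real n - 4) < 2 * real (card (edges G))"
    using distance_spectral_radius_edges[OF assms(2,3,4)] by (simp add: algebra_simps)
  then have "real_of_int (int n * (int n - 4)) < real_of_int (2 * int (card (edges G)))" by simp
  then have dense: "int n * (int n - 4) < 2 * int (card (edges G))" by (simp only: of_int_less_iff)
  have "degree_in G v \<ge> k + 2" if "v \<in> verts G" for v
  proof -
    have "min_degree G \<le> degree_in G v" unfolding min_degree_def using fin that by (intro Min_le) auto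
    then show ?thesis using assms(6) by simp
  qed
  from dense_graph_partition_condition[OF assms(2,4,5) this dense]
  obtain T where T: "\<And>i. i < k + 1 \<Longrightarrow> spanning_tree (T i) G"
    "\<And>i. i < k + 1 \<Longrightarrow> card (edges (T i)) = order_graph G - 1"
    "\<And>i j. i < k + 1 \<Longrightarrow> j < k + 1 \<Longrightarrow> i \<noteq> j \<Longrightarrow> edge_disjoint (T i) (T j)"
    using spanning_tree_packing[OF assms(2) ne, of "k + 1"] by blast
  \<comment> \<open>The trees with index below \<open>k\<close> are the required ones, and the last,
    \<open>T k\<close>, is the forest. It has \<open>n - 1\<close> edges, more than the required
    fraction of \<open>n - 1\<close>, and is itself a spanning tree.\<close>
  have F: "spanning_tree (T k) G" using T(1) by simp
  have "(real (min_degree G) - 1) / real (min_degree G) * (real n - 1) < real n - 1"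
    using assms(5,6) by (simp add: field_simps)
  also have "\<dots> = real (card (edges (T k)))" using T(2)[of k] assms(4,5) by (simp add: of_nat_diff)
  finally show ?thesis
    unfolding property_P_def using T F assms(4)
    by (intro exI[of _ T] exI[of _ "T k"]) (auto simp: spanning_tree_def tree_def)
qed

end
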